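(* Let $E$ be any directed graph, let $K$ be any field, and let $v$ be a line point in $E$. Then the formal series left $L_K(E)$-module $X_v^E := K[[F^+_E(T(v))]]^{sf}$ is the injective envelope of the simple left ideal $L_K(E)v$ in the category of (unitary) left $L_K(E)$-modules, where $L_K(E)v$ is regarded as a submodule of $X_v^E$ by identifying the element $\mu p^*_{v,r(\mu)}\in L_K(E)v$ with the function $F^+_E(T(v))\to K$ taking value $1$ at $\mu$ and $0$ elsewhere ($\mu\in F^+_E(T(v))$).
   Context: Leavitt path algebra: for a directed graph $E=(E^0,E^1,s,r)$ (no finiteness or countability assumption) and a field $K$, $L_K(E)$ is the associative $K$-algebra (not necessarily unital) generated by $\{u: u\in E^0\}\cup\{e,e^*: e\in E^1\}$ subject to: $uw=\delta_{u,w}u$ for $u,w\in E^0$; $s(e)e=e=e\,r(e)$ and $r(e)e^*=e^*=e^*s(e)$ for $e\in E^1$; (CK1) $e^*f=\delta_{e,f}r(e)$ for $e,f\in E^1$; (CK2) $u=\sum_{e\in s^{-1}(u)}ee^*$ for every regular vertex $u$ (i.e. $0<|s^{-1}(u)|<\infty$). Finite sums of distinct vertices form a set of local units. A left $L_K(E)$-module $M$ is required to be unitary: $L_K(E)M=M$. Paths: $\mathrm{Path}(E)$ is the set of vertices (length $0$) together with finite sequences $e_1\cdots e_m$ of edges with $r(e_i)=s(e_{i+1})$; for $\mu=e_1\cdots e_m$, $\mu^*=e_m^*\cdots e_1^*$, and $u^*=u$ for a vertex $u$. Write $u\ge w$ if there is a path from $u$ to $w$. For $v\in E^0$, $T(v)=\{w\in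 E^0: v\ge w\}$. Line point: $v\in E^0$ is a line point if no vertex of $T(v)$ is a bifurcation (i.e. emits two or more edges) or is the base of a cycle. For a line point $v$ and $w\in T(v)$, $p_{v,w}$ denotes the unique path from $v$ to $w$. It is known that $L_K(E)v$ is a simple left ideal if and only if $v$ is a line point. $F^+_E(T(v))$ is the disjoint union of $T(v)$ and the set of paths $e_1\cdots e_n$ ($n\ge1$) with $s(e_1)\notin T(v)$, $r(e_i)\notin T(v)$ for $1\le i<n$, and $r(e_n)\in T(v)$. $K[[F^+_E(T(v))]]$ is the $K$-space of all functions $\mathfrak p:F^+_E(T(v))\to K$, written as formal series $\mathfrak p=\sum_{\mu}k_\mu\,\mu p^*_{v,r(\mu)}$ with $k_\mu=\mathfrak p(\mu)$. $\mathfrak p$ is source finite if $\{s(\mu):\mathfrak p(\mu)\ne0\}$ is finite; $K[[F^+_E(T(v))]]^{sf}$ is the subspace of source finite series. The action of $L_K(E)$ on $K[[F^+_E(T(v))]]$ is determined by letting $u\in E^0$, $e$, $e^*$ ($e\in E^1$) act as the $K$-endomorphisms $P_u,S_e,S_{e^*}$: $P_u(\mathfrak p)(\mu)=\mathfrak p(\mu)$ if $s(\mu)=u$, and $0$ otherwise. If $s(e)\notin T(v)$: $S_e(\mathfrak p)(\mu)=\mathfrak p(\mu')$ if $\mu=e\mu'$, and $0$ otherwise; $S_{e^*}(\mathfrak p)(\mu)=\mathfrak p(e\mu)$ if $s(\mu)=r(e)$, and $0$ otherwise. If $s(e)\in T(v)$: $S_e(\mathfrak p)(\mu)=\mathfrak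 p(r(e))$ if $\mu=s(e)$, and $0$ otherwise; $S_{e^*}(\mathfrak p)(\mu)=\mathfrak p(s(e))$ if $\mu=r(e)$, and $0$ otherwise. (This amounts to multiplying each term of the series on the left by $u$, $e$, $e^*$.) This action restricts to a unitary left $L_K(E)$-module structure on $K[[F^+_E(T(v))]]^{sf}$. *)

theory Defs
  imports "HOL-Algebra.QuotRing" "HOL-Algebra.Module" "HOL-Algebra.Generated_Groups"
    "Graph_Theory.Arc_Walk"
begin

text \<open>
  Directed graphs are the (possibly infinite, multi-arc) digraphs of \<^locale>\<open>wf_digraph\<close>:
  \<open>tail\<close> is the source map and \<open>head\<close> is the range map.
\<close>

section \<open>Leavitt path algebras\<close>

datatype ('v, 'e) lpa_gen = Vertex 'v | Edge 'e | Ghost 'e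

definition lpa_gens :: "('v, 'e) pre_digraph \<Rightarrow> ('v, 'e) lpa_gen set" where
  "lpa_gens E = Vertex ` verts E \<union> Edge ` arcs E \<union> Ghost ` arcs E"

text \<open>
  The free non-unital associative algebra on a set \<open>X\<close>: finitely supported functions on the
  nonempty words over \<open>X\<close>, with convolution as product.  The record type is that of the library,
  so it has a field \<open>one\<close>; it carries no meaning here.
\<close>

definition free_algebra :: "'x set \<Rightarrow> ('k::field, 'x list \<Rightarrow> 'k) module" where
  "free_algebra X =
    \<lparr>carrier = {f. finite {w. f w \<noteq> 0} \<and> (\<forall>w. f w \<noteq> 0 \<longrightarrow> w \<noteq> [] \<and> set w \<subseteq> X)},
     mult = (\<lambda>f g w. \<Sum>i\<le>length w. f (take i w) * g (drop i w)),
     one = undefined,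
     zero = (\<lambda>w. 0),
     add = (\<lambda>f g w. f w + g w),
     smult = (\<lambda>k f w. k * f w)\<rparr>"

definition word :: "'x list \<Rightarrow> 'x list \<Rightarrow> 'k::field" where
  "word w = (\<lambda>w'. if w' = w then 1 else 0)"

text \<open>A pair \<open>(a, b)\<close> stands for the defining relation \<open>a = b\<close>.\<close>

inductive_set lpa_relations ::
    "('v, 'e) pre_digraph \<Rightarrow>
      ((('v, 'e) lpa_gen list \<Rightarrow> 'k::field) \<times> (('v, 'e) lpa_gen list \<Rightarrow> 'k)) set"
  for E where
  vertices: "u \<in> verts E \<Longrightarrow> w \<in> verts E \<Longrightarrow>
      (word [Vertex u, Vertex w], if u = w then word [Vertex u] else (\<lambda>_. 0)) \<in> lpa_relations E"
| source: "e \<in> arcs E \<Longrightarrow> (word [Vertex (tail E e), Edge e], word [Edge e]) \<in> lpa_relations E"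
| range: "e \<in> arcs E \<Longrightarrow> (word [Edge e, Vertex (head E e)], word [Edge e]) \<in> lpa_relations E"
| ghost_range: "e \<in> arcs E \<Longrightarrow>
      (word [Vertex (head E e), Ghost e], word [Ghost e]) \<in> lpa_relations E"
| ghost_source: "e \<in> arcs E \<Longrightarrow>
      (word [Ghost e, Vertex (tail E e)], word [Ghost e]) \<in> lpa_relations E"
| CK1: "e \<in> arcs E \<Longrightarrow> f \<in> arcs E \<Longrightarrow>
      (word [Ghost e, Edge f], if e = f then word [Vertex (head E e)] else (\<lambda>_. 0))
        \<in> lpa_relations E"
| CK2: "u \<in> verts E \<Longrightarrow> finite {e \<in> arcs E. tail E e = u} \<Longrightarrow> {e \<in> arcs E. tail E e = u} \<noteq> {} \<Longrightarrow>
      (word [Vertex u], \<lambda>x. \<Sum>e\<in>{e \<in> arcs E. tail E e = u}. word [Edge e, Ghost e] x)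
        \<in> lpa_relations E"

inductive_set lpa_ideal ::
    "('v, 'e) pre_digraph \<Rightarrow> (('v, 'e) lpa_gen list \<Rightarrow> 'k::field) set"
  for E where
  rel: "(a, b) \<in> lpa_relations E \<Longrightarrow> (\<lambda>w. a w - b w) \<in> lpa_ideal E"
| zero: "(\<lambda>_. 0) \<in> lpa_ideal E"
| add: "a \<in> lpa_ideal E \<Longrightarrow> b \<in> lpa_ideal E \<Longrightarrow> a \<oplus>\<^bsub>free_algebra (lpa_gens E)\<^esub> b \<in> lpa_ideal E"
| smult: "a \<in> lpa_ideal E \<Longrightarrow> k \<odot>\<^bsub>free_algebra (lpa_gens E)\<^esub> a \<in> lpa_ideal E"
| mult_left: "a \<in> lpa_ideal E \<Longrightarrow> c \<in> carrier (free_algebra (lpa_gens E)) \<Longrightarrow>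
      c \<otimes>\<^bsub>free_algebra (lpa_gens E)\<^esub> a \<in> lpa_ideal E"
| mult_right: "a \<in> lpa_ideal E \<Longrightarrow> c \<in> carrier (free_algebra (lpa_gens E)) \<Longrightarrow>
      a \<otimes>\<^bsub>free_algebra (lpa_gens E)\<^esub> c \<in> lpa_ideal E"

text \<open>
  Only the ring structure is recorded: on a unitary module over a ring with local units that is
  a \<open>K\<close>-algebra, the \<open>K\<close>-space structure is determined by the ring action, and additive maps
  commuting with the ring action are automatically \<open>K\<close>-linear.
\<close>

definition leavitt_path_algebra ::
    "('v, 'e) pre_digraph \<Rightarrow> (('v, 'e) lpa_gen list \<Rightarrow> 'k::field) set ring" where
  "leavitt_path_algebra E = free_algebra (lpa_gens E) Quot lpa_ideal E"

definition lpa_class ::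
    "('v, 'e) pre_digraph \<Rightarrow> ('v, 'e) lpa_gen \<Rightarrow> (('v, 'e) lpa_gen list \<Rightarrow> 'k::field) set" where
  "lpa_class E g = lpa_ideal E +>\<^bsub>free_algebra (lpa_gens E)\<^esub> word [g]"


section \<open>Unitary left modules over a possibly non-unital ring\<close>

text \<open>
  The fields \<open>mult\<close> and \<open>one\<close> of the module \<open>M\<close> are ignored throughout.  In \<open>unitary\<close>, the
  additive subgroup generated by the products \<open>r m\<close> is \<open>RM\<close>.
\<close>

locale unitary_left_module =
  fixes R :: "('r, 'c) ring_scheme" (structure) and M :: "('r, 'm, 'd) module_scheme"
  assumes abelian_group: "abelian_group M"
    and smult_closed: "r \<in> carrier R \<Longrightarrow> x \<in> carrier M \<Longrightarrow> r \<odot>\<^bsub>M\<^esub> x \<in> carrier M"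
    and smult_l_distr: "r \<in> carrier R \<Longrightarrow> s \<in> carrier R \<Longrightarrow> x \<in> carrier M \<Longrightarrow>
      (r \<oplus> s) \<odot>\<^bsub>M\<^esub> x = r \<odot>\<^bsub>M\<^esub> x \<oplus>\<^bsub>M\<^esub> s \<odot>\<^bsub>M\<^esub> x"
    and smult_r_distr: "r \<in> carrier R \<Longrightarrow> x \<in> carrier M \<Longrightarrow> y \<in> carrier M \<Longrightarrow>
      r \<odot>\<^bsub>M\<^esub> (x \<oplus>\<^bsub>M\<^esub> y) = r \<odot>\<^bsub>M\<^esub> x \<oplus>\<^bsub>M\<^esub> r \<odot>\<^bsub>M\<^esub> y"
    and smult_assoc: "r \<in> carrier R \<Longrightarrow> s \<in> carrier R \<Longrightarrow> x \<in> carrier M \<Longrightarrow>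
      (r \<otimes> s) \<odot>\<^bsub>M\<^esub> x = r \<odot>\<^bsub>M\<^esub> (s \<odot>\<^bsub>M\<^esub> x)"
    and unitary: "generate (add_monoid M) {r \<odot>\<^bsub>M\<^esub> x | r x. r \<in> carrier R \<and> x \<in> carrier M}
      = carrier M"

definition left_module_hom ::
    "('r, 'c) ring_scheme \<Rightarrow> ('r, 'm, 'd) module_scheme \<Rightarrow> ('r, 'n, 'f) module_scheme \<Rightarrow>
      ('m \<Rightarrow> 'n) set" where
  "left_module_hom R M N =
    {h \<in> carrier M \<rightarrow> carrier N.
      (\<forall>x\<in>carrier M. \<forall>y\<in>carrier M. h (x \<oplus>\<^bsub>M\<^esub> y) = h x \<oplus>\<^bsub>N\<^esub> h y) \<and>
      (\<forall>r\<in>carrier R. \<forall>x\<in>carrier M. h (r \<odot>\<^bsub>M\<^esub> x) = r \<odot>\<^bsub>N\<^esub> h x)}"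

text \<open>
  Injectivity in the category of unitary left modules.  A formula cannot quantify over types, so
  the types of the elements of the test modules \<open>A\<close> and \<open>B\<close> are parameters; injectivity is the
  assertion for all types \<open>'a\<close> and \<open>'b\<close>, which is what a theorem with these type variables free
  states.
\<close>

definition injective_module ::
    "'a itself \<Rightarrow> 'b itself \<Rightarrow> ('r, 'c) ring_scheme \<Rightarrow> ('r, 'm, 'd) module_scheme \<Rightarrow> bool" where
  "injective_module TA TB R X \<longleftrightarrow>
    (\<forall>(A :: ('r, 'a) module) (B :: ('r, 'b) module) f g.
      unitary_left_module R A \<longrightarrow> unitary_left_module R B \<longrightarrow>
      f \<in> left_module_hom R A B \<longrightarrow> inj_on f (carrier A) \<longrightarrow> g \<in> left_module_hom R A X \<longrightarrow>
      (\<exists>h \<in> left_module_hom R B X. \<forall>x\<in>carrier A. h (f x) = g x))"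

definition essential_in ::
    "'m set \<Rightarrow> ('r, 'c) ring_scheme \<Rightarrow> ('r, 'm, 'd) module_scheme \<Rightarrow> bool" where
  "essential_in S R X \<longleftrightarrow> submodule S R X \<and>
    (\<forall>N. submodule N R X \<longrightarrow> N \<noteq> {\<zero>\<^bsub>X\<^esub>} \<longrightarrow> N \<inter> S \<noteq> {\<zero>\<^bsub>X\<^esub>})"

definition injective_envelope ::
    "'a itself \<Rightarrow> 'b itself \<Rightarrow> ('r, 'c) ring_scheme \<Rightarrow> ('r, 's, 'd) module_scheme \<Rightarrow>
      ('r, 'm, 'f) module_scheme \<Rightarrow> ('s \<Rightarrow> 'm) \<Rightarrow> bool" where
  "injective_envelope TA TB R S X \<phi> \<longleftrightarrow>
    unitary_left_module R S \<and> unitary_left_module R X \<and>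
    \<phi> \<in> left_module_hom R S X \<and> inj_on \<phi> (carrier S) \<and>
    essential_in (\<phi> ` carrier S) R X \<and> injective_module TA TB R X"

definition principal_left_ideal :: "('r, 'c) ring_scheme \<Rightarrow> 'r \<Rightarrow> ('r, 'r) module" where
  "principal_left_ideal R x =
    \<lparr>carrier = (\<lambda>a. a \<otimes>\<^bsub>R\<^esub> x) ` carrier R,
     mult = (\<otimes>\<^bsub>R\<^esub>), one = \<one>\<^bsub>R\<^esub>, zero = \<zero>\<^bsub>R\<^esub>, add = (\<oplus>\<^bsub>R\<^esub>), smult = (\<otimes>\<^bsub>R\<^esub>)\<rparr>"


section \<open>Line points and the formal series module\<close>

definition tree :: "('v, 'e) pre_digraph \<Rightarrow> 'v \<Rightarrow> 'v set" where
  "tree E v = {w \<in> verts E. \<exists>es. pre_digraph.awalk E v es w}"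

definition bifurcation :: "('v, 'e) pre_digraph \<Rightarrow> 'v \<Rightarrow> bool" where
  "bifurcation E w \<longleftrightarrow> (\<exists>e\<in>arcs E. \<exists>f\<in>arcs E. e \<noteq> f \<and> tail E e = w \<and> tail E f = w)"

definition cycle_base :: "('v, 'e) pre_digraph \<Rightarrow> 'v \<Rightarrow> bool" where
  "cycle_base E w \<longleftrightarrow> (\<exists>c. pre_digraph.cycle E c \<and> pre_digraph.awalk E w c w)"

definition line_point :: "('v, 'e) pre_digraph \<Rightarrow> 'v \<Rightarrow> bool" where
  "line_point E v \<longleftrightarrow> v \<in> verts E \<and> (\<forall>w\<in>tree E v. \<not> bifurcation E w \<and> \<not> cycle_base E w)"

text \<open>
  A path is a pair \<open>(u, es)\<close> of its source \<open>u\<close> and its list of edges; the vertex \<open>u\<close> is the path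
  \<open>(u, [])\<close>.
\<close>

type_synonym ('v, 'e) path = "'v \<times> 'e list"

definition path_range :: "('v, 'e) pre_digraph \<Rightarrow> ('v, 'e) path \<Rightarrow> 'v" where
  "path_range E \<mu> = (if snd \<mu> = [] then fst \<mu> else head E (last (snd \<mu>)))"

definition paths_into_tree :: "('v, 'e) pre_digraph \<Rightarrow> 'v \<Rightarrow> ('v, 'e) path set" where
  "paths_into_tree E v =
    {(w, []) | w. w \<in> tree E v} \<union>
    {(u, es) | u es. es \<noteq> [] \<and> pre_digraph.awalk E u es (path_range E (u, es)) \<and>
      u \<notin> tree E v \<and> (\<forall>e\<in>set (butlast es). head E e \<notin> tree E v) \<and>
      path_range E (u, es) \<in> tree E v}"

text \<open>
  In \<open>L\<^sub>K(E)\<close> the path \<open>e\<^sub>1\<cdots>e\<^sub>m\<close> starting at \<open>u\<close> equals \<open>u e\<^sub>1\<cdots>e\<^sub>m\<close> and its ghost equals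
  \<open>e\<^sub>m\<^sup>*\<cdots>e\<^sub>1\<^sup>*u\<close>; including \<open>u\<close> covers paths of length \<open>0\<close> uniformly.
\<close>

definition path_elt ::
    "('v, 'e) pre_digraph \<Rightarrow> ('v, 'e) path \<Rightarrow> (('v, 'e) lpa_gen list \<Rightarrow> 'k::field) set" where
  "path_elt E \<mu> =
    foldl (\<lambda>a e. a \<otimes>\<^bsub>leavitt_path_algebra E\<^esub> lpa_class E (Edge e))
      (lpa_class E (Vertex (fst \<mu>))) (snd \<mu>)"

definition ghost_elt ::
    "('v, 'e) pre_digraph \<Rightarrow> ('v, 'e) path \<Rightarrow> (('v, 'e) lpa_gen list \<Rightarrow> 'k::field) set" where
  "ghost_elt E \<mu> =
    foldl (\<lambda>a e. lpa_class E (Ghost e) \<otimes>\<^bsub>leavitt_path_algebra E\<^esub> a)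
      (lpa_class E (Vertex (fst \<mu>))) (snd \<mu>)"

text \<open>The path \<open>p\<^sub>v\<^sub>,\<^sub>w\<close>, meaningful when there is exactly one path from \<open>v\<close> to \<open>w\<close>.\<close>

definition the_path :: "('v, 'e) pre_digraph \<Rightarrow> 'v \<Rightarrow> 'v \<Rightarrow> ('v, 'e) path" where
  "the_path E v w = (v, THE es. pre_digraph.awalk E v es w)"

definition series_term ::
    "('v, 'e) pre_digraph \<Rightarrow> 'v \<Rightarrow> ('v, 'e) path \<Rightarrow> (('v, 'e) lpa_gen list \<Rightarrow> 'k::field) set" where
  "series_term E v \<mu> =
    path_elt E \<mu> \<otimes>\<^bsub>leavitt_path_algebra E\<^esub> ghost_elt E (the_path E v (path_range E \<mu>))"

text \<open>
  A formal series is a function on all pairs that vanishes outside \<^const>\<open>paths_into_tree\<close>.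
  The operators below are only applied to such functions, and preserve them.
\<close>

fun gen_action ::
    "('v, 'e) pre_digraph \<Rightarrow> 'v \<Rightarrow> ('v, 'e) lpa_gen \<Rightarrow>
      (('v, 'e) path \<Rightarrow> 'k::field) \<Rightarrow> ('v, 'e) path \<Rightarrow> 'k" where
  "gen_action E v (Vertex u) p \<mu> = (if fst \<mu> = u then p \<mu> else 0)"
| "gen_action E v (Edge e) p \<mu> =
    (if tail E e \<notin> tree E v then
      (if \<exists>es. \<mu> = (tail E e, e # es) then p (head E e, tl (snd \<mu>)) else 0)
     else (if \<mu> = (tail E e, []) then p (head E e, []) else 0))"
| "gen_action E v (Ghost e) p \<mu> =
    (if tail E e \<notin> tree E v then
      (if fst \<mu> = head E e then p (tail E e, e # snd \<mu>) else 0)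
     else (if \<mu> = (head E e, []) then p (tail E e, []) else 0))"

definition free_action ::
    "('v, 'e) pre_digraph \<Rightarrow> 'v \<Rightarrow> (('v, 'e) lpa_gen list \<Rightarrow> 'k::field) \<Rightarrow>
      (('v, 'e) path \<Rightarrow> 'k) \<Rightarrow> ('v, 'e) path \<Rightarrow> 'k" where
  "free_action E v f p = (\<lambda>\<mu>. \<Sum>w\<in>{w. f w \<noteq> 0}. f w * foldr (gen_action E v) w p \<mu>)"

text \<open>
  The action of a class is that of any representative: for a line point \<open>v\<close> the operators
  satisfy the defining relations of \<open>L\<^sub>K(E)\<close> on formal series.
\<close>

definition formal_series_module ::
    "('v, 'e) pre_digraph \<Rightarrow> 'v \<Rightarrow>
      ((('v, 'e) lpa_gen list \<Rightarrow> 'k::field) set, ('v, 'e) path \<Rightarrow> 'k) module" where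
  "formal_series_module E v =
    \<lparr>carrier = {p. (\<forall>\<mu>. \<mu> \<notin> paths_into_tree E v \<longrightarrow> p \<mu> = 0) \<and> finite (fst ` {\<mu>. p \<mu> \<noteq> 0})},
     mult = undefined,
     one = undefined,
     zero = (\<lambda>_. 0),
     add = (\<lambda>p q \<mu>. p \<mu> + q \<mu>),
     smult = (\<lambda>c p. free_action E v (SOME f. f \<in> c) p)\<rparr>"

end

theory Submission
  imports Defs
begin

text \<open>
  Write \<open>L\<close> for the Leavitt path algebra, \<open>x\<^sub>\<mu> = \<mu> p\<^sup>*\<close> for the monomials indexed by the paths \<open>\<mu>\<close> into
  the tree of \<open>v\<close>, and \<open>y\<^sub>\<mu> = p \<mu>\<^sup>*\<close> for their adjoints, where \<open>p\<close> is the path from \<open>v\<close> to the range of \<open>\<mu>\<close>.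
  The \<open>y\<^sub>\<mu>\<close> span the projective right ideal \<open>vL\<close>, and the formal series module is the unitary part of its
  dual \<open>Hom\<^sub>K(vL, K)\<close>.  Hence homomorphisms from a unitary module \<open>M\<close> into it correspond to linear
  functionals on \<open>vM\<close>: explicitly, a functional \<open>m\<close> yields the map sending \<open>b\<close> to the series
  \<open>\<mu> \<mapsto> m (y\<^sub>\<mu> b)\<close>.  Injectivity thus reduces to the extension of linear functionals.  The embedding of
  \<open>Lv\<close> is \<open>c \<mapsto> c \<cdot> \<delta>\<^sub>v\<close>.  It maps \<open>x\<^sub>\<mu>\<close> to \<open>\<delta>\<^sub>\<mu>\<close>, so it is injective because the \<open>x\<^sub>\<mu>\<close> span \<open>Lv\<close>, and it is
  essential because \<open>y\<^sub>\<mu> p = p(\<mu>) \<delta>\<^sub>v\<close> for every series \<open>p\<close>.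
\<close>

section \<open>Non-unital rings\<close>

text \<open>The computations rest on one combinatorial fact: every generator \<open>g\<close> moves
  the index paths by a partial injection, \<open>step\<close>. A series is pulled back along
  \<open>step g\<close>, right multiplication by \<open>g\<close> moves the
  \<open>y\<^sub>\<mu>\<close> along \<open>step g\<close>, and left multiplication moves the
  \<open>x\<^sub>\<mu>\<close> and the delta series along the inverse map
  \<open>step (star g)\<close>. Every index is reached from the trivial path at \<open>v\<close>, so
  an identity needs checking only there and along one step. The line point condition makes this
  work: without cycles the path \<open>p\<close> is unique, and without bifurcations an edge
  starting in the tree cancels against its own ghost by CK2. The rules for
  \<open>y\<^sub>\<mu>\<close> are those for \<open>x\<^sub>\<mu>\<close> in the opposite ring with
  edges and ghost edges exchanged. The algebra may lack an identity and its modules carry no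
  explicit scalars. On \<open>vM\<close> the scalar \<open>k\<close> is recovered as the action of
  \<open>k v\<close>, and only functionals on such spaces occur. Unitarity enters through
  finiteness: an element of a unitary module is killed by all but finitely many vertices, which
  makes the series built from a functional source finite.\<close>

locale nonunital_ring = abelian_group R for R (structure) +
  assumes m_closed: "x \<in> carrier R \<Longrightarrow> y \<in> carrier R \<Longrightarrow> x \<otimes> y \<in> carrier R"
    and m_assoc: "x \<in> carrier R \<Longrightarrow> y \<in> carrier R \<Longrightarrow> z \<in> carrier R \<Longrightarrow>
      (x \<otimes> y) \<otimes> z = x \<otimes> (y \<otimes> z)"
    and l_distr: "x \<in> carrier R \<Longrightarrow> y \<in> carrier R \<Longrightarrow> z \<in> carrier R \<Longrightarrow>
      (x \<oplus> y) \<otimes> z = x \<otimes> z \<oplus> y \<otimes> z"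
    and r_distr: "x \<in> carrier R \<Longrightarrow> y \<in> carrier R \<Longrightarrow> z \<in> carrier R \<Longrightarrow>
      z \<otimes> (x \<oplus> y) = z \<otimes> x \<oplus> z \<otimes> y"
begin

lemma double_eq_zero:
  assumes "x \<in> carrier R" "x \<oplus> x = x"
  shows "x = \<zero>"
  using assms add.r_cancel_one by metis

lemma l_null: "x \<in> carrier R \<Longrightarrow> \<zero> \<otimes> x = \<zero>"
  using l_distr[of \<zero> \<zero> x] by (intro double_eq_zero) (auto simp: m_closed)

lemma r_null: "x \<in> carrier R \<Longrightarrow> x \<otimes> \<zero> = \<zero>"
  using r_distr[of \<zero> \<zero> x] by (intro double_eq_zero) (auto simp: m_closed)

end


section \<open>Unitary modules\<close>

text \<open>In the modules built below every element is a single product \<open>r y\<close>, so the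
  generated subgroup in the definition of unitarity never has to be analysed.\<close>

lemma unitary_left_moduleI:
  assumes "abelian_group M"
    and closed: "\<And>r x. r \<in> carrier R \<Longrightarrow> x \<in> carrier M \<Longrightarrow> r \<odot>\<^bsub>M\<^esub> x \<in> carrier M"
    and "\<And>r s x. r \<in> carrier R \<Longrightarrow> s \<in> carrier R \<Longrightarrow> x \<in> carrier M \<Longrightarrow>
      (r \<oplus>\<^bsub>R\<^esub> s) \<odot>\<^bsub>M\<^esub> x = r \<odot>\<^bsub>M\<^esub> x \<oplus>\<^bsub>M\<^esub> s \<odot>\<^bsub>M\<^esub> x"
    and "\<And>r x y. r \<in> carrier R \<Longrightarrow> x \<in> carrier M \<Longrightarrow> y \<in> carrier M \<Longrightarrow>
      r \<odot>\<^bsub>M\<^esub> (x \<oplus>\<^bsub>M\<^esub> y) = r \<odot>\<^bsub>M\<^esub> x \<oplus>\<^bsub>M\<^esub> r \<odot>\<^bsub>M\<^esub> y"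
    and "\<And>r s x. r \<in> carrier R \<Longrightarrow> s \<in> carrier R \<Longrightarrow> x \<in> carrier M \<Longrightarrow>
      (r \<otimes>\<^bsub>R\<^esub> s) \<odot>\<^bsub>M\<^esub> x = r \<odot>\<^bsub>M\<^esub> (s \<odot>\<^bsub>M\<^esub> x)"
    and factor: "\<And>x. x \<in> carrier M \<Longrightarrow> \<exists>r\<in>carrier R. \<exists>y\<in>carrier M. x = r \<odot>\<^bsub>M\<^esub> y"
  shows "unitary_left_module R M"
proof (rule unitary_left_module.intro)
  interpret M: abelian_group M by fact
  let ?G = "{r \<odot>\<^bsub>M\<^esub> x |r x. r \<in> carrier R \<and> x \<in> carrier M}"
  have "?G = carrier M" using closed factor by blast
  then show "generate (add_monoid M) ?G = carrier M"
    using M.add.generate_incl[of "carrier M"] generate.incl[of _ "carrier M" "add_monoid M"] by auto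
qed (fact assms)+

locale nonunital_module = nonunital_ring R + unitary_left_module R M
  for R (structure) and M :: "('r, 'm, 'd) module_scheme"
begin

sublocale M: abelian_group M
  by (rule abelian_group)

lemma smult_zero: "r \<in> carrier R \<Longrightarrow> r \<odot>\<^bsub>M\<^esub> \<zero>\<^bsub>M\<^esub> = \<zero>\<^bsub>M\<^esub>"
  using smult_r_distr[of r "\<zero>\<^bsub>M\<^esub>" "\<zero>\<^bsub>M\<^esub>"] smult_closed[of r "\<zero>\<^bsub>M\<^esub>"] M.add.r_cancel_one by simp

lemma zero_smult: "x \<in> carrier M \<Longrightarrow> \<zero> \<odot>\<^bsub>M\<^esub> x = \<zero>\<^bsub>M\<^esub>"
  using smult_l_distr[of \<zero> \<zero> x] smult_closed[of \<zero> x] M.add.r_cancel_one by simp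

end

context nonunital_ring
begin

lemma principal_left_ideal_simps [simp]:
  "carrier (principal_left_ideal R x) = (\<lambda>a. a \<otimes> x) ` carrier R"
  "a \<oplus>\<^bsub>principal_left_ideal R x\<^esub> b = a \<oplus> b"
  "a \<odot>\<^bsub>principal_left_ideal R x\<^esub> b = a \<otimes> b"
  "\<zero>\<^bsub>principal_left_ideal R x\<^esub> = \<zero>"
  by (simp_all add: principal_left_ideal_def)

text \<open>Idempotence puts \<open>x\<close> itself into \<open>R x\<close>; hence
  \<open>r x\<close> is already a ring element times an element of the module.\<close>

lemma principal_left_ideal_module:
  assumes x: "x \<in> carrier R" "x \<otimes> x = x"
  shows "unitary_left_module R (principal_left_ideal R x)"
proof (rule unitary_left_moduleI)
  let ?M = "principal_left_ideal R x"
  show "abelian_group ?M"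
  proof (rule abelian_groupI)
    show "\<zero>\<^bsub>?M\<^esub> \<in> carrier ?M" using l_null[OF x(1)] by (auto intro!: image_eqI[of _ _ \<zero>])
    show "a \<oplus>\<^bsub>?M\<^esub> b \<in> carrier ?M" if "a \<in> carrier ?M" "b \<in> carrier ?M" for a b
      using that x by (auto simp: l_distr[symmetric])
    show "\<exists>b\<in>carrier ?M. b \<oplus>\<^bsub>?M\<^esub> a = \<zero>\<^bsub>?M\<^esub>" if a: "a \<in> carrier ?M" for a
    proof -
      obtain c where c: "c \<in> carrier R" "a = c \<otimes> x" using a by auto
      then have "(\<ominus> c) \<otimes> x \<oplus> a = \<zero>" using x by (simp add: l_distr[symmetric] l_neg l_null)
      then show ?thesis using c by auto
    qed
  qed (use x in \<open>auto simp: m_closed a_ac\<close>)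
  show "\<exists>r\<in>carrier R. \<exists>z\<in>carrier ?M. y = r \<odot>\<^bsub>?M\<^esub> z" if y: "y \<in> carrier ?M" for y
  proof -
    obtain r where "r \<in> carrier R" "y = r \<odot>\<^bsub>?M\<^esub> x" using y by auto
    moreover have "x \<in> carrier ?M" using x by force
    ultimately show ?thesis by blast
  qed
  show "r \<odot>\<^bsub>?M\<^esub> y \<in> carrier ?M" if "r \<in> carrier R" "y \<in> carrier ?M" for r y
    using that x by (auto simp: m_assoc[symmetric] m_closed)
qed (use x in \<open>auto simp: l_distr r_distr m_assoc m_closed\<close>)

end

lemma left_module_hom_zero:
  assumes "abelian_group M" "abelian_group N" "h \<in> left_module_hom R M N"
  shows "h \<zero>\<^bsub>M\<^esub> = \<zero>\<^bsub>N\<^esub>"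
proof -
  interpret M: abelian_group M by fact
  interpret N: abelian_group N by fact
  have "h \<zero>\<^bsub>M\<^esub> \<oplus>\<^bsub>N\<^esub> h \<zero>\<^bsub>M\<^esub> = h (\<zero>\<^bsub>M\<^esub> \<oplus>\<^bsub>M\<^esub> \<zero>\<^bsub>M\<^esub>)" and "h \<zero>\<^bsub>M\<^esub> \<in> carrier N"
    using assms(3) M.zero_closed by (auto simp: left_module_hom_def simp del: M.l_zero M.r_zero)
  then show ?thesis using N.add.r_cancel_one by simp
qed


section \<open>Extension of linear functionals\<close>

text \<open>Zorn's lemma on graphs of partial functionals. The scalar laws are assumed on
  \<open>W\<close> only, because in the application \<open>W\<close> is the part of a module fixed
  by \<open>v\<close> and \<open>sc k\<close> is the action of \<open>k v\<close>, which satisfies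
  \<open>sc 1 x = x\<close> exactly there.\<close>

lemma (in abelian_group) extend_functional:
  fixes sc :: "'k::field \<Rightarrow> 'a \<Rightarrow> 'a" and l :: "'a \<Rightarrow> 'k"
  assumes W: "W \<subseteq> carrier G" "\<And>x y. x \<in> W \<Longrightarrow> y \<in> W \<Longrightarrow> x \<oplus> y \<in> W" "\<And>k x. x \<in> W \<Longrightarrow> sc k x \<in> W"
    and sc: "\<And>a b x. x \<in> W \<Longrightarrow> sc (a + b) x = sc a x \<oplus> sc b x"
      "\<And>a x y. x \<in> W \<Longrightarrow> y \<in> W \<Longrightarrow> sc a (x \<oplus> y) = sc a x \<oplus> sc a y"
      "\<And>a b x. x \<in> W \<Longrightarrow> sc (a * b) x = sc a (sc b x)"
      "\<And>x. x \<in> W \<Longrightarrow> sc 1 x = x"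
    and U: "U \<subseteq> W" "\<zero> \<in> U" "\<And>x y. x \<in> U \<Longrightarrow> y \<in> U \<Longrightarrow> x \<oplus> y \<in> U" "\<And>k x. x \<in> U \<Longrightarrow> sc k x \<in> U"
    and l: "\<And>x y. x \<in> U \<Longrightarrow> y \<in> U \<Longrightarrow> l (x \<oplus> y) = l x + l y" "\<And>k x. x \<in> U \<Longrightarrow> l (sc k x) = k * l x"
  obtains m :: "'a \<Rightarrow> 'k" where
    "\<And>x y. x \<in> W \<Longrightarrow> y \<in> W \<Longrightarrow> m (x \<oplus> y) = m x + m y" "\<And>k x. x \<in> W \<Longrightarrow> m (sc k x) = k * m x"
    "\<And>x. x \<in> U \<Longrightarrow> m x = l x"
proof -
  \<comment> \<open>Since a member is closed under sums and scalars, requiring that only 0 lies over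
    \<open>\<zero>\<close> says that it is single-valued. In this form the condition passes to
    unions of chains at once.\<close>
  define \<A> where "\<A> = {\<Gamma>. \<Gamma> \<subseteq> W \<times> UNIV \<and> (\<forall>x\<in>U. (x, l x) \<in> \<Gamma>) \<and>
    (\<forall>x a y b. (x, a) \<in> \<Gamma> \<longrightarrow> (y, b) \<in> \<Gamma> \<longrightarrow> (x \<oplus> y, a + b) \<in> \<Gamma>) \<and>
    (\<forall>k x a. (x, a) \<in> \<Gamma> \<longrightarrow> (sc k x, k * a) \<in> \<Gamma>) \<and> (\<forall>a. (\<zero>, a) \<in> \<Gamma> \<longrightarrow> a = 0)}"
  have W_carrier: "x \<in> carrier G" if "x \<in> W" for x using W(1) that by blast
  have zero_W: "\<zero> \<in> W" using U by blast
  have sc_0: "sc 0 x = \<zero>" if "x \<in> W" for x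
    using sc(1)[OF that, of 0 0] W_carrier[OF W(3)[OF that]] add.r_cancel_one by simp
  have sc_zero: "sc k \<zero> = \<zero>" for k
    using sc(3)[OF zero_W, of k 0] sc_0[OF zero_W] by simp
  have sc_minus: "x \<oplus> sc (- 1) x = \<zero>" if "x \<in> W" for x
    using sc(1)[OF that, of 1 "-1"] sc(4)[OF that] sc_0[OF that] by simp
  have l_zero: "l \<zero> = 0" using l(2)[OF U(2), of 0] sc_zero by simp
  have "\<exists>M\<in>\<A>. \<forall>\<Gamma>\<in>\<A>. M \<subseteq> \<Gamma> \<longrightarrow> \<Gamma> = M"
  proof (rule subset_Zorn_nonempty)
    have "{(x, a). x \<in> U \<and> a = l x} \<in> \<A>"
      unfolding \<A>_def using U(1) U(3,4) l l_zero by fastforce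
    then show "\<A> \<noteq> {}" by blast
    fix C assume C: "C \<noteq> {}" "subset.chain \<A> C"
    then have CA: "\<Gamma> \<in> \<A>" if "\<Gamma> \<in> C" for \<Gamma> using that by (auto simp: subset.chain_def)
    have add: "(x \<oplus> y, a + b) \<in> \<Union>C" if xy: "(x, a) \<in> \<Union>C" "(y, b) \<in> \<Union>C" for x a y b
    proof -
      obtain \<Gamma> where "\<Gamma> \<in> C" "(x, a) \<in> \<Gamma>" "(y, b) \<in> \<Gamma>"
        using xy C(2) unfolding subset_chain_def by blast
      then show ?thesis using CA[of \<Gamma>] unfolding \<A>_def by blast
    qed
    have each: "\<Gamma> \<subseteq> W \<times> UNIV" "\<forall>x\<in>U. (x, l x) \<in> \<Gamma>" "\<forall>k x a. (x, a) \<in> \<Gamma> \<longrightarrow> (sc k x, k * a) \<in> \<Gamma>"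
      "\<forall>a. (\<zero>, a) \<in> \<Gamma> \<longrightarrow> a = 0" if "\<Gamma> \<in> C" for \<Gamma>
      using CA[OF that] unfolding \<A>_def by simp_all
    show "\<Union>C \<in> \<A>"
      unfolding \<A>_def
    proof (intro CollectI conjI)
      show "\<Union>C \<subseteq> W \<times> UNIV" using each(1) by blast
      show "\<forall>x\<in>U. (x, l x) \<in> \<Union>C" using each(2) C(1) by blast
      show "\<forall>k x a. (x, a) \<in> \<Union>C \<longrightarrow> (sc k x, k * a) \<in> \<Union>C" using each(3) by blast
      show "\<forall>a. (\<zero>, a) \<in> \<Union>C \<longrightarrow> a = 0" using each(4) by blast
    qed (use add in blast)
  qed
  then obtain M where M: "M \<in> \<A>" and max: "\<And>\<Gamma>. \<Gamma> \<in> \<A> \<Longrightarrow> M \<subseteq> \<Gamma> \<Longrightarrow> \<Gamma> = M" by blast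
  have M_W: "x \<in> W" if "(x, a) \<in> M" for x a using M that unfolding \<A>_def by blast
  have M_l: "(x, l x) \<in> M" if "x \<in> U" for x using M that unfolding \<A>_def by blast
  have M_add: "(x \<oplus> y, a + b) \<in> M" if "(x, a) \<in> M" "(y, b) \<in> M" for x y a b
    using M that unfolding \<A>_def by blast
  have M_sc: "(sc k x, k * a) \<in> M" if "(x, a) \<in> M" for k x a
    using M that unfolding \<A>_def by blast
  have M_zero: "a = 0" if "(\<zero>, a) \<in> M" for a using M that unfolding \<A>_def by blast
  have zero_M: "(\<zero>, 0) \<in> M" using M_l[OF U(2)] l_zero by simp
  \<comment> \<open>Subtracting the two pairs gives \<open>(\<zero>, a - b)\<close>.\<close>
  have unique: "a = b" if "(x, a) \<in> M" "(x, b) \<in> M" for x a b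
    using M_zero[of "a + (- 1) * b"] M_add[OF that(1) M_sc[OF that(2), of "-1"]] sc_minus[OF M_W[OF that(1)]]
    by simp
  have total: "\<exists>a. (x, a) \<in> M" if x: "x \<in> W" for x
  proof (rule ccontr)
    assume nex: "\<nexists>a. (x, a) \<in> M"
    \<comment> \<open>The extension of \<open>M\<close> that takes the value 0 at
      \<open>x\<close>.\<close>
    define M' where "M' = {(y \<oplus> sc c x, a) | y c a. (y, a) \<in> M}"
    have mem: "(y \<oplus> sc c x, a) \<in> M'" if "(y, a) \<in> M" for y c a using that unfolding M'_def by blast
    have "M \<subseteq> M'"
    proof
      fix z assume z: "z \<in> M"
      obtain y a where ya: "z = (y, a)" by (cases z)
      then have "y \<oplus> sc 0 x = y" using sc_0[OF x] M_W W_carrier z by auto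
      then show "z \<in> M'" using mem[of y a 0] z ya by simp
    qed
    moreover have "M' \<in> \<A>"
    proof -
      have "M' \<subseteq> W \<times> UNIV" using M_W W x unfolding M'_def by blast
      moreover have "(z \<oplus> z', a + b) \<in> M'" if zz: "(z, a) \<in> M'" "(z', b) \<in> M'" for z a z' b
      proof -
        obtain y c where y: "z = y \<oplus> sc c x" "(y, a) \<in> M" using zz(1) unfolding M'_def by blast
        obtain y' c' where y': "z' = y' \<oplus> sc c' x" "(y', b) \<in> M" using zz(2) unfolding M'_def by blast
        have "z \<oplus> z' = (y \<oplus> y') \<oplus> sc (c + c') x"
          unfolding y(1) y'(1) using W_carrier M_W y(2) y'(2) W(3)[OF x] by (simp add: sc(1)[OF x] a_ac)
        then show ?thesis using mem[OF M_add[OF y(2) y'(2)]] by simp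
      qed
      moreover have "(sc k z, k * a) \<in> M'" if z: "(z, a) \<in> M'" for k z a
      proof -
        obtain y c where y: "z = y \<oplus> sc c x" "(y, a) \<in> M" using z unfolding M'_def by blast
        have "sc k z = sc k y \<oplus> sc (k * c) x"
          unfolding y(1) using sc(2)[OF M_W[OF y(2)] W(3)[OF x]] sc(3)[OF x] by simp
        then show ?thesis using mem[OF M_sc[OF y(2)]] by simp
      qed
      moreover have "a = 0" if a: "(\<zero>, a) \<in> M'" for a
      proof -
        obtain y c where y: "\<zero> = y \<oplus> sc c x" "(y, a) \<in> M" using a unfolding M'_def by blast
        note yW = M_W[OF y(2)]
        show ?thesis
        proof (cases "c = 0")
          case True
          then have "y = \<zero>" using y(1) sc_0[OF x] W_carrier[OF yW] by simp
          then show ?thesis using y(2) M_zero by simp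
        next
          case False
          \<comment> \<open>Solving \<open>y + c x = \<zero>\<close> for \<open>x\<close> would
            place \<open>x\<close> in the domain of \<open>M\<close>.\<close>
          let ?z = "sc (1 / c) y"
          have zW: "?z \<in> W" "sc (- 1) ?z \<in> W" using W(3) yW by auto
          have "\<zero> = ?z \<oplus> x"
            using sc(2)[OF yW W(3)[OF x], of "1 / c" c] sc(3)[OF x, of "1 / c" c] False
            by (simp add: y(1)[symmetric] sc_zero sc(4)[OF x])
          then have "x = sc (- 1) ?z"
            using sc_minus[OF zW(1)] W_carrier zW x
            by (metis a_comm minus_equality)
          then show ?thesis using M_sc[OF M_sc[OF y(2)]] nex by metis
        qed
      qed
      ultimately show ?thesis using \<open>M \<subseteq> M'\<close> M_l unfolding \<A>_def by blast
    qed
    ultimately have "M' = M" by (rule max[rotated])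
    moreover have "x = \<zero> \<oplus> sc 1 x" using sc(4)[OF x] W_carrier[OF x] by simp
    ultimately have "(x, 0) \<in> M" using mem[OF zero_M, of 1] by simp
    then show False using nex by blast
  qed
  define m where "m x = (THE a. (x, a) \<in> M)" for x
  have m_eq: "m x = a" if "(x, a) \<in> M" for x a
    unfolding m_def using that unique by blast
  have m_mem: "(x, m x) \<in> M" if "x \<in> W" for x using total[OF that] m_eq by blast
  show thesis
  proof
    show "m (x \<oplus> y) = m x + m y" if "x \<in> W" "y \<in> W" for x y
      by (rule m_eq[OF M_add[OF m_mem[OF that(1)] m_mem[OF that(2)]]])
    show "m (sc k x) = k * m x" if "x \<in> W" for k x
      by (rule m_eq[OF M_sc[OF m_mem[OF that]]])
    show "m x = l x" if "x \<in> U" for x by (rule m_eq[OF M_l[OF that]])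
  qed
qed


section \<open>The free algebra\<close>

lemma free_algebra_simps [simp]:
  "f \<oplus>\<^bsub>free_algebra X\<^esub> g = (\<lambda>w. f w + g w)"
  "k \<odot>\<^bsub>free_algebra X\<^esub> f = (\<lambda>w. k * f w)"
  "\<zero>\<^bsub>free_algebra X\<^esub> = (\<lambda>w. 0)"
  by (simp_all add: free_algebra_def)

lemma free_algebra_mult:
  "f \<otimes>\<^bsub>free_algebra X\<^esub> g = (\<lambda>w. \<Sum>i\<le>length w. f (take i w) * g (drop i w))"
  by (simp add: free_algebra_def)

lemma free_algebra_carrier:
  "f \<in> carrier (free_algebra X) \<longleftrightarrow>
    finite {w. f w \<noteq> 0} \<and> (\<forall>w. f w \<noteq> 0 \<longrightarrow> w \<noteq> [] \<and> set w \<subseteq> X)"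
  by (simp add: free_algebra_def)

lemma free_algebra_add_closed:
  assumes "f \<in> carrier (free_algebra X)" "g \<in> carrier (free_algebra X)"
  shows "(\<lambda>w. f w + g w) \<in> carrier (free_algebra X)"
proof -
  have "finite ({w. f w \<noteq> 0} \<union> {w. g w \<noteq> 0})"
    using assms by (auto simp: free_algebra_carrier)
  then have "finite {w. f w + g w \<noteq> 0}"
    by (rule rev_finite_subset) auto
  moreover have "w \<noteq> [] \<and> set w \<subseteq> X" if "f w + g w \<noteq> 0" for w
    using assms that unfolding free_algebra_carrier by (metis add.right_neutral)
  ultimately show ?thesis by (auto simp: free_algebra_carrier)
qed

lemma free_algebra_smult_closed:
  assumes "f \<in> carrier (free_algebra X)"
  shows "(\<lambda>w. k * f w) \<in> carrier (free_algebra X)"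
proof -
  have "finite {w. k * f w \<noteq> 0}"
    by (rule rev_finite_subset[of "{w. f w \<noteq> 0}"]) (use assms in \<open>auto simp: free_algebra_carrier\<close>)
  then show ?thesis using assms by (auto simp: free_algebra_carrier)
qed

lemma free_algebra_zero_closed [simp]: "(\<lambda>w. 0) \<in> carrier (free_algebra X)"
  by (simp add: free_algebra_carrier)

lemma word_closed [simp]:
  "w \<noteq> [] \<Longrightarrow> set w \<subseteq> X \<Longrightarrow> word w \<in> carrier (free_algebra X)"
  by (auto simp: free_algebra_carrier word_def)

lemma free_algebra_mult_closed:
  assumes "f \<in> carrier (free_algebra X)" "g \<in> carrier (free_algebra X)"
  shows "f \<otimes>\<^bsub>free_algebra X\<^esub> g \<in> carrier (free_algebra X)"
proof -
  let ?h = "f \<otimes>\<^bsub>free_algebra X\<^esub> g"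
  have factor: "\<exists>a b. f a \<noteq> 0 \<and> g b \<noteq> 0 \<and> w = a @ b" if nz: "?h w \<noteq> 0" for w
  proof -
    obtain i where "f (take i w) * g (drop i w) \<noteq> 0"
      using nz unfolding free_algebra_mult by (meson sum.not_neutral_contains_not_neutral)
    then have "f (take i w) \<noteq> 0 \<and> g (drop i w) \<noteq> 0 \<and> w = take i w @ drop i w"
      by auto
    then show ?thesis by blast
  qed
  have "{w. ?h w \<noteq> 0} \<subseteq> (\<lambda>(a, b). a @ b) ` ({w. f w \<noteq> 0} \<times> {w. g w \<noteq> 0})"
    using factor by fastforce
  then have "finite {w. ?h w \<noteq> 0}"
    by (rule finite_subset) (use assms in \<open>auto simp: free_algebra_carrier\<close>)
  moreover have "w \<noteq> [] \<and> set w \<subseteq> X" if nz: "?h w \<noteq> 0" for w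
  proof -
    obtain a b where "f a \<noteq> 0" "g b \<noteq> 0" "w = a @ b" using factor[OF nz] by blast
    then show ?thesis using assms by (auto simp: free_algebra_carrier)
  qed
  ultimately show ?thesis by (simp add: free_algebra_carrier)
qed

text \<open>Both sides sum over the ways to cut a word into three pieces: the left side is indexed
  by the two cut positions, the right side by the lengths of the first two pieces.\<close>

lemma free_algebra_mult_assoc:
  fixes f g h :: "'x list \<Rightarrow> 'k::field"
  shows "(f \<otimes>\<^bsub>free_algebra X\<^esub> g) \<otimes>\<^bsub>free_algebra X\<^esub> h = f \<otimes>\<^bsub>free_algebra X\<^esub> (g \<otimes>\<^bsub>free_algebra X\<^esub> h)"
proof
  fix w :: "'x list"
  let ?n = "length w"
  let ?F = "\<lambda>i j. f (take i w) * (g (take j (drop i w)) * h (drop (i + j) w))"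
  have "((f \<otimes>\<^bsub>free_algebra X\<^esub> g) \<otimes>\<^bsub>free_algebra X\<^esub> h) w = (\<Sum>k\<le>?n. \<Sum>i\<le>k. ?F i (k - i))"
    unfolding free_algebra_mult sum_distrib_right
    by (intro sum.cong) (auto simp: drop_take mult.assoc min_def)
  also have "\<dots> = (\<Sum>(i, j)\<in>{(i, j). i + j \<le> ?n}. ?F i j)"
    by (rule sum.triangle_reindex_eq[symmetric])
  also have "{(i, j). i + j \<le> ?n} = Sigma {..?n} (\<lambda>i. {..?n - i})"
    by auto
  also have "(\<Sum>(i, j)\<in>Sigma {..?n} (\<lambda>i. {..?n - i}). ?F i j) = (\<Sum>i\<le>?n. \<Sum>j\<le>?n - i. ?F i j)"
    by (simp add: sum.Sigma)
  also have "\<dots> = (f \<otimes>\<^bsub>free_algebra X\<^esub> (g \<otimes>\<^bsub>free_algebra X\<^esub> h)) w"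
    unfolding free_algebra_mult sum_distrib_left
    by (intro sum.cong) (auto simp: add.commute)
  finally show "((f \<otimes>\<^bsub>free_algebra X\<^esub> g) \<otimes>\<^bsub>free_algebra X\<^esub> h) w
    = (f \<otimes>\<^bsub>free_algebra X\<^esub> (g \<otimes>\<^bsub>free_algebra X\<^esub> h)) w" .
qed

lemma free_algebra_l_distr:
  "(\<lambda>w. f w + g w) \<otimes>\<^bsub>free_algebra X\<^esub> h =
    (\<lambda>w. (f \<otimes>\<^bsub>free_algebra X\<^esub> h) w + (g \<otimes>\<^bsub>free_algebra X\<^esub> h) w)"
  by (simp add: free_algebra_mult distrib_right sum.distrib)

lemma free_algebra_r_distr:
  "h \<otimes>\<^bsub>free_algebra X\<^esub> (\<lambda>w. f w + g w) =
    (\<lambda>w. (h \<otimes>\<^bsub>free_algebra X\<^esub> f) w + (h \<otimes>\<^bsub>free_algebra X\<^esub> g) w)"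
  by (simp add: free_algebra_mult distrib_left sum.distrib)

lemma free_algebra_smult_l:
  "(\<lambda>w. k * f w) \<otimes>\<^bsub>free_algebra X\<^esub> g = (\<lambda>w. k * (f \<otimes>\<^bsub>free_algebra X\<^esub> g) w)"
  by (simp add: free_algebra_mult sum_distrib_left mult.assoc)

lemma free_algebra_smult_r:
  "f \<otimes>\<^bsub>free_algebra X\<^esub> (\<lambda>w. k * g w) = (\<lambda>w. k * (f \<otimes>\<^bsub>free_algebra X\<^esub> g) w)"
  by (simp add: free_algebra_mult sum_distrib_left mult.left_commute)

lemma word_mult:
  "word a \<otimes>\<^bsub>free_algebra X\<^esub> word b = (word (a @ b) :: 'x list \<Rightarrow> 'k::field)"
proof
  fix w :: "'x list"
  have eq: "word a (take i w) * word b (drop i w) =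
      (if i = length a then if w = a @ b then 1 else 0 else (0::'k))" if "i \<le> length w" for i
  proof -
    have "take i w = a \<and> drop i w = b \<longleftrightarrow> i = length a \<and> w = a @ b"
      using that by (metis append_eq_conv_conj append_take_drop_id length_take min.absorb2)
    moreover have "word a x * word b y = (if x = a \<and> y = b then 1 else (0::'k))" for x y
      by (simp add: word_def)
    ultimately show ?thesis by simp
  qed
  have "(word a \<otimes>\<^bsub>free_algebra X\<^esub> word b) w =
      (\<Sum>i\<le>length w. if i = length a then if w = a @ b then 1 else 0 else (0::'k))"
    unfolding free_algebra_mult using eq by (intro sum.cong) auto
  also have "\<dots> = word (a @ b) w"
    by (auto simp: word_def)
  finally show "(word a \<otimes>\<^bsub>free_algebra X\<^esub> word b) w = (word (a @ b) w :: 'k)" .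
qed

lemma free_algebra_nonunital_ring: "nonunital_ring (free_algebra X)"
proof (intro nonunital_ring.intro nonunital_ring_axioms.intro abelian_groupI)
  fix f :: "'a list \<Rightarrow> 'b"
  assume f: "f \<in> carrier (free_algebra X)"
  show "\<exists>g\<in>carrier (free_algebra X). g \<oplus>\<^bsub>free_algebra X\<^esub> f = \<zero>\<^bsub>free_algebra X\<^esub>"
    using free_algebra_smult_closed[OF f, of "-1"] by (intro bexI[of _ "\<lambda>w. (-1) * f w"]) auto
qed (auto simp: free_algebra_add_closed free_algebra_mult_closed free_algebra_mult_assoc
    free_algebra_l_distr free_algebra_r_distr algebra_simps)

text \<open>The support is finite, so splitting off one word at a time reduces additive claims to
  scalar multiples of single words.\<close>

lemma free_algebra_induct [consumes 1, case_names zero word add]: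
  assumes "f \<in> carrier (free_algebra X)"
    and zero: "P (\<lambda>_. 0)"
    and word: "\<And>k w. w \<noteq> [] \<Longrightarrow> set w \<subseteq> X \<Longrightarrow> P (\<lambda>x. k * word w x)"
    and add: "\<And>f g. f \<in> carrier (free_algebra X) \<Longrightarrow> g \<in> carrier (free_algebra X) \<Longrightarrow>
      P f \<Longrightarrow> P g \<Longrightarrow> P (\<lambda>w. f w + g w)"
  shows "P f"
proof -
  have "P f" if "finite A" "{w. f w \<noteq> 0} = A" "\<forall>w\<in>A. w \<noteq> [] \<and> set w \<subseteq> X" for f A
    using that
  proof (induction A arbitrary: f rule: finite_induct)
    case empty
    then have "f = (\<lambda>_. 0)" by auto
    then show ?case using zero by simp
  next
    case (insert a A)
    let ?g = "f(a := 0)" and ?h = "\<lambda>x. f a * word a x"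
    have supp: "{w. ?g w \<noteq> 0} = A" using insert.hyps insert.prems by auto
    then have "w \<in> A" if "?g w \<noteq> 0" for w using that by blast
    then have g: "P ?g" "?g \<in> carrier (free_algebra X)"
      using insert.IH[OF supp] insert.prems(2) insert.hyps(1)
      unfolding free_algebra_carrier supp by blast+
    have h: "P ?h" "?h \<in> carrier (free_algebra X)"
      using insert.prems by (auto intro: word free_algebra_smult_closed)
    have "f = (\<lambda>w. ?g w + ?h w)" by (auto simp: word_def)
    then show ?case using add[OF g(2) h(2) g(1) h(1)] by simp
  qed
  then show ?thesis using assms(1) unfolding free_algebra_carrier by blast
qed


section \<open>Leavitt path algebras\<close>

locale leavitt_algebra = wf_digraph E for E :: "('v, 'e) pre_digraph" +
  fixes K :: "'k::field itself"
begin

abbreviation F :: "('k, ('v, 'e) lpa_gen list \<Rightarrow> 'k) module" where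
  "F \<equiv> free_algebra (lpa_gens E)"

abbreviation I :: "(('v, 'e) lpa_gen list \<Rightarrow> 'k) set" where
  "I \<equiv> lpa_ideal E"

abbreviation L :: "(('v, 'e) lpa_gen list \<Rightarrow> 'k) set ring" where
  "L \<equiv> leavitt_path_algebra E"

definition cls :: "(('v, 'e) lpa_gen list \<Rightarrow> 'k) \<Rightarrow> (('v, 'e) lpa_gen list \<Rightarrow> 'k) set" where
  "cls f = I +>\<^bsub>F\<^esub> f"

text \<open>The scalar multiplication that the ring record of the quotient does not store. All
  representatives of \<open>c\<close> give the same class (\<open>scale_cls\<close>), so the union
  is a single class.\<close>

definition scale :: "'k \<Rightarrow> (('v, 'e) lpa_gen list \<Rightarrow> 'k) set \<Rightarrow> (('v, 'e) lpa_gen list \<Rightarrow> 'k) set" where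
  "scale k c = (\<Union>f\<in>c. cls (\<lambda>w. k * f w))"

abbreviation gen :: "('v, 'e) lpa_gen \<Rightarrow> (('v, 'e) lpa_gen list \<Rightarrow> 'k) set" where
  "gen \<equiv> lpa_class E"

lemma gens_simps [simp]:
  "Vertex u \<in> lpa_gens E \<longleftrightarrow> u \<in> verts E"
  "Edge e \<in> lpa_gens E \<longleftrightarrow> e \<in> arcs E"
  "Ghost e \<in> lpa_gens E \<longleftrightarrow> e \<in> arcs E"
  by (auto simp: lpa_gens_def)

interpretation F: nonunital_ring F
  by (rule free_algebra_nonunital_ring)

lemma minus_closed: "f \<in> carrier F \<Longrightarrow> g \<in> carrier F \<Longrightarrow> (\<lambda>w. f w - g w) \<in> carrier F"
  using free_algebra_add_closed[of f "lpa_gens E" "\<lambda>w. (-1) * g w"]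
    free_algebra_smult_closed[of g "lpa_gens E" "-1"] by simp

lemma sum_closed: "finite A \<Longrightarrow> (\<And>a. a \<in> A \<Longrightarrow> f a \<in> carrier F) \<Longrightarrow> (\<lambda>w. \<Sum>a\<in>A. f a w) \<in> carrier F"
  by (induction A rule: finite_induct) (auto intro!: free_algebra_add_closed)

lemma relations_closed:
  "(a, b) \<in> lpa_relations E \<Longrightarrow> a \<in> carrier F \<and> b \<in> carrier F"
  by (induction rule: lpa_relations.induct) (auto intro!: sum_closed)

lemma ideal_closed: "a \<in> I \<Longrightarrow> a \<in> carrier F"
  by (induction rule: lpa_ideal.induct)
    (auto intro: minus_closed free_algebra_add_closed free_algebra_smult_closed
      free_algebra_mult_closed dest: relations_closed)

interpretation I: abelian_subgroup I F
proof (rule abelian_subgroupI3[OF additive_subgroupI F.abelian_group_axioms])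
  show "subgroup I (add_monoid F)"
  proof (intro F.add.subgroupI)
    show "I \<noteq> {}" using lpa_ideal.zero by blast
    fix a assume a: "a \<in> I"
    have "\<ominus>\<^bsub>F\<^esub> a = (\<lambda>w. (-1) * a w)"
      using ideal_closed[OF a] free_algebra_smult_closed[of a "lpa_gens E" "-1"]
      by (intro F.minus_equality) auto
    then show "\<ominus>\<^bsub>F\<^esub> a \<in> I"
      using lpa_ideal.smult[OF a, of "-1"] by simp
    fix b assume "b \<in> I"
    then show "a \<oplus>\<^bsub>F\<^esub> b \<in> I" using lpa_ideal.add[OF a] by simp
  qed (use ideal_closed in auto)
qed

section \<open>The quotient computed with representatives\<close>

lemma cls_memD: "g \<in> cls f \<Longrightarrow> \<exists>i\<in>I. g = (\<lambda>w. i w + f w)"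
  by (auto simp: cls_def a_r_coset_def')

lemma cls_eqI:
  assumes "f \<in> carrier F" "g \<in> carrier F" "(\<lambda>w. f w - g w) \<in> I"
  shows "cls f = cls g"
proof -
  have "f \<in> cls g" using assms(3) unfolding cls_def a_r_coset_def' by force
  then show ?thesis unfolding cls_def by (rule I.a_repr_independence'[symmetric, OF _ assms(2)])
qed

lemma cls_memE:
  assumes "g \<in> cls f" "f \<in> carrier F"
  shows "g \<in> carrier F" "cls g = cls f" "(\<lambda>w. g w - f w) \<in> I"
proof -
  obtain i where i: "i \<in> I" "g = (\<lambda>w. i w + f w)" using cls_memD[OF assms(1)] by blast
  show "g \<in> carrier F" using i assms ideal_closed free_algebra_add_closed by blast
  then show "cls g = cls f" using i assms(2) by (intro cls_eqI) auto
  show "(\<lambda>w. g w - f w) \<in> I" using i by simp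
qed

lemma cls_self: "f \<in> carrier F \<Longrightarrow> f \<in> cls f"
  unfolding cls_def by (rule I.a_rcos_self)

lemma carrier_L: "carrier L = cls ` carrier F"
  by (auto simp: leavitt_path_algebra_def FactRing_def A_RCOSETS_def' cls_def a_r_coset_def')

lemma cls_closed [simp]: "f \<in> carrier F \<Longrightarrow> cls f \<in> carrier L"
  by (simp add: carrier_L)

lemma cls_add:
  "f \<in> carrier F \<Longrightarrow> g \<in> carrier F \<Longrightarrow> cls f \<oplus>\<^bsub>L\<^esub> cls g = cls (\<lambda>w. f w + g w)"
  by (simp add: leavitt_path_algebra_def FactRing_def cls_def I.a_rcos_sum)

lemma zero_L: "\<zero>\<^bsub>L\<^esub> = cls (\<lambda>_. 0)"
  using F.a_coset_add_zero[OF I.a_subset] by (simp add: leavitt_path_algebra_def FactRing_def cls_def)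

text \<open>The quotient product is a union over representatives. For \<open>a = i + f\<close> and
  \<open>b = j + g\<close> with \<open>i\<close>, \<open>j\<close> in the ideal,
  \<open>a b - f g = i b + f j\<close> lies in the ideal, so all classes in the union
  coincide.\<close>

lemma cls_mult:
  assumes f: "f \<in> carrier F" and g: "g \<in> carrier F"
  shows "cls f \<otimes>\<^bsub>L\<^esub> cls g = cls (f \<otimes>\<^bsub>F\<^esub> g)"
proof -
  have "cls (a \<otimes>\<^bsub>F\<^esub> b) = cls (f \<otimes>\<^bsub>F\<^esub> g)" if a: "a \<in> cls f" and b: "b \<in> cls g" for a b
  proof -
    obtain i where i: "i \<in> I" "a = (\<lambda>w. i w + f w)" using cls_memD[OF a] by blast
    obtain j where j: "j \<in> I" "b = (\<lambda>w. j w + g w)" using cls_memD[OF b] by blast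
    have cb: "b \<in> carrier F" and ca: "a \<in> carrier F" using cls_memE(1)[OF b g] cls_memE(1)[OF a f] by auto
    have "(\<lambda>w. (i \<otimes>\<^bsub>F\<^esub> b) w + (f \<otimes>\<^bsub>F\<^esub> j) w) \<in> I"
      using lpa_ideal.add[OF lpa_ideal.mult_right[OF i(1) cb] lpa_ideal.mult_left[OF j(1) f]] by simp
    moreover have "(\<lambda>w. (a \<otimes>\<^bsub>F\<^esub> b) w - (f \<otimes>\<^bsub>F\<^esub> g) w) = (\<lambda>w. (i \<otimes>\<^bsub>F\<^esub> b) w + (f \<otimes>\<^bsub>F\<^esub> j) w)"
      unfolding i(2) free_algebra_l_distr unfolding j(2) free_algebra_r_distr by auto
    ultimately show ?thesis
      using ca cb f g by (intro cls_eqI) (auto intro: free_algebra_mult_closed)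
  qed
  moreover have "cls f \<otimes>\<^bsub>L\<^esub> cls g = (\<Union>a\<in>cls f. \<Union>b\<in>cls g. cls (a \<otimes>\<^bsub>F\<^esub> b))"
    by (simp add: leavitt_path_algebra_def FactRing_def rcoset_mult_def cls_def)
  ultimately show ?thesis using cls_self f g by blast
qed

lemma scale_cls: "f \<in> carrier F \<Longrightarrow> scale k (cls f) = cls (\<lambda>w. k * f w)"
proof -
  assume f: "f \<in> carrier F"
  have "cls (\<lambda>w. k * g w) = cls (\<lambda>w. k * f w)" if g: "g \<in> cls f" for g
  proof (rule cls_eqI)
    show "(\<lambda>w. k * g w - k * f w) \<in> I"
      using lpa_ideal.smult[OF cls_memE(3)[OF g f], of k] by (simp add: right_diff_distrib)
  qed (use f cls_memE(1)[OF g f] in \<open>simp_all add: free_algebra_smult_closed\<close>)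
  then show ?thesis unfolding scale_def using cls_self[OF f] by blast
qed

lemma L_nonunital_ring: "nonunital_ring L"
proof (intro nonunital_ring.intro nonunital_ring_axioms.intro)
  show "abelian_group L"
    by (rule comm_group_abelian_groupI)
      (simp add: leavitt_path_algebra_def FactRing_def I.a_factorgroup_is_comm_group[unfolded A_FactGroup_def'])
qed (auto simp: carrier_L cls_mult cls_add free_algebra_add_closed free_algebra_mult_closed
    free_algebra_mult_assoc free_algebra_l_distr free_algebra_r_distr)

sublocale L: nonunital_ring L
  by (rule L_nonunital_ring)

lemma scale_closed [simp]: "c \<in> carrier L \<Longrightarrow> scale k c \<in> carrier L"
  by (auto simp: carrier_L scale_cls free_algebra_smult_closed)

lemma scale_mult_l:
  "c \<in> carrier L \<Longrightarrow> d \<in> carrier L \<Longrightarrow> scale k c \<otimes>\<^bsub>L\<^esub> d = scale k (c \<otimes>\<^bsub>L\<^esub> d)"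
  by (auto simp: carrier_L scale_cls cls_mult free_algebra_smult_closed free_algebra_mult_closed
    free_algebra_smult_l)

lemma scale_mult_r:
  "c \<in> carrier L \<Longrightarrow> d \<in> carrier L \<Longrightarrow> c \<otimes>\<^bsub>L\<^esub> scale k d = scale k (c \<otimes>\<^bsub>L\<^esub> d)"
  by (auto simp: carrier_L scale_cls cls_mult free_algebra_smult_closed free_algebra_mult_closed
    free_algebra_smult_r)

lemma scale_add_l: "c \<in> carrier L \<Longrightarrow> scale (k + l) c = scale k c \<oplus>\<^bsub>L\<^esub> scale l c"
  by (auto simp: carrier_L scale_cls cls_add free_algebra_smult_closed distrib_right)

lemma scale_scale: "c \<in> carrier L \<Longrightarrow> scale k (scale l c) = scale (k * l) c"
  by (auto simp: carrier_L scale_cls free_algebra_smult_closed mult.assoc)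

lemma scale_one: "c \<in> carrier L \<Longrightarrow> scale 1 c = c"
  by (auto simp: carrier_L scale_cls)

lemma scale_0: "c \<in> carrier L \<Longrightarrow> scale 0 c = \<zero>\<^bsub>L\<^esub>"
  by (auto simp: carrier_L scale_cls zero_L)

lemma scale_zero: "scale k \<zero>\<^bsub>L\<^esub> = \<zero>\<^bsub>L\<^esub>"
  by (auto simp: scale_cls zero_L)

lemma gen_cls: "gen g = cls (word [g])"
  by (simp add: lpa_class_def cls_def)

lemma gen_closed [simp]: "g \<in> lpa_gens E \<Longrightarrow> gen g \<in> carrier L"
  by (simp add: gen_cls)

lemma gen_mult:
  "g \<in> lpa_gens E \<Longrightarrow> h \<in> lpa_gens E \<Longrightarrow> gen g \<otimes>\<^bsub>L\<^esub> gen h = cls (word [g, h])"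
  by (simp add: gen_cls cls_mult word_mult)

text \<open>Scalars are attached to the generators only: in a multiple of a word the first letter
  can carry the coefficient, so scalar multiples need no case of their own.\<close>

lemma L_induct [consumes 1, case_names zero gen add mult]:
  assumes "c \<in> carrier L"
    and zero: "P \<zero>\<^bsub>L\<^esub>"
    and gen: "\<And>k g. g \<in> lpa_gens E \<Longrightarrow> P (scale k (gen g))"
    and add: "\<And>c d. c \<in> carrier L \<Longrightarrow> d \<in> carrier L \<Longrightarrow> P c \<Longrightarrow> P d \<Longrightarrow> P (c \<oplus>\<^bsub>L\<^esub> d)"
    and mult: "\<And>c d. c \<in> carrier L \<Longrightarrow> d \<in> carrier L \<Longrightarrow> P c \<Longrightarrow> P d \<Longrightarrow> P (c \<otimes>\<^bsub>L\<^esub> d)"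
  shows "P c"
proof -
  have word: "P (cls (\<lambda>x. k * word w x))" if "w \<noteq> []" "set w \<subseteq> lpa_gens E" for k w
    using that
  proof (induction w arbitrary: k rule: list_nonempty_induct)
    case (single g)
    then show ?case using gen[of g k] by (simp add: gen_cls scale_cls)
  next
    case (cons g w)
    have c: "(\<lambda>x. k * word [g] x) \<in> carrier F" "word w \<in> carrier F"
      using cons by (auto intro: free_algebra_smult_closed)
    have "P (cls (\<lambda>x. k * word [g] x) \<otimes>\<^bsub>L\<^esub> cls (word w))"
      using cons.IH[of 1] gen[of g k] cons.prems c
      by (intro mult) (auto simp: gen_cls scale_cls)
    then show ?case using c by (simp add: cls_mult free_algebra_smult_l word_mult)
  qed
  have "P (cls f)" if "f \<in> carrier F" for f
    using that
  proof (induction rule: free_algebra_induct)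
    case zero
    then show ?case using assms(2) by (simp add: zero_L)
  next
    case (add f g)
    then show ?case using assms(4)[of "cls f" "cls g"] by (simp add: cls_add)
  qed (use word in auto)
  then show ?thesis using assms(1) by (auto simp: carrier_L)
qed

lemma relation_cls: "(a, b) \<in> lpa_relations E \<Longrightarrow> cls a = cls b"
  using relations_closed by (intro cls_eqI lpa_ideal.rel) auto

end


section \<open>Paths into the tree of a line point\<close>

fun star :: "('v, 'e) lpa_gen \<Rightarrow> ('v, 'e) lpa_gen" where
  "star (Vertex u) = Vertex u"
| "star (Edge e) = Ghost e"
| "star (Ghost e) = Edge e"

lemma star_star [simp]: "star (star g) = g"
  by (cases g) auto

lemma star_gens [simp]: "star g \<in> lpa_gens E \<longleftrightarrow> g \<in> lpa_gens E"
  by (cases g) (auto simp: lpa_gens_def)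

text \<open>
  Every generator acts on formal series by composition with a partial injection of the index set;
  the partial injections of \<open>e\<close> and \<open>e\<^sup>*\<close> are inverse to each other.
\<close>

fun step :: "('v, 'e) pre_digraph \<Rightarrow> 'v \<Rightarrow> ('v, 'e) lpa_gen \<Rightarrow> ('v, 'e) path \<Rightarrow> ('v, 'e) path option" where
  "step E v (Vertex u) \<mu> = (if fst \<mu> = u then Some \<mu> else None)"
| "step E v (Edge e) \<mu> =
    (if tail E e \<notin> tree E v then
      (if \<exists>es. \<mu> = (tail E e, e # es) then Some (head E e, tl (snd \<mu>)) else None)
     else (if \<mu> = (tail E e, []) then Some (head E e, []) else None))"
| "step E v (Ghost e) \<mu> =
    (if tail E e \<notin> tree E v then
      (if fst \<mu> = head E e then Some (tail E e, e # snd \<mu>) else None)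
     else (if \<mu> = (head E e, []) then Some (tail E e, []) else None))"

lemma gen_action_step:
  "gen_action E v g p \<mu> = (case step E v g \<mu> of None \<Rightarrow> 0 | Some \<nu> \<Rightarrow> p \<nu>)"
  by (cases g) auto

lemma step_star_iff: "step E v (star g) \<nu> = Some \<mu> \<longleftrightarrow> step E v g \<mu> = Some \<nu>"
  by (cases g; cases \<mu>; cases \<nu>) auto

locale line_point_graph = wf_digraph E for E :: "('v, 'e) pre_digraph" +
  fixes v :: 'v
  assumes line_point: "line_point E v"
begin

abbreviation T :: "'v set" where "T \<equiv> tree E v"

abbreviation P :: "('v, 'e) path set" where "P \<equiv> paths_into_tree E v"

section \<open>Walks inside the tree of a line point\<close>

lemma v_vert: "v \<in> verts E"
  using line_point by (simp add: line_point_def)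

lemma tree_iff: "w \<in> T \<longleftrightarrow> (\<exists>es. awalk v es w)"
  by (auto simp: tree_def dest: awalk_last_in_verts)

lemma v_tree [simp]: "v \<in> T"
  unfolding tree_iff using v_vert by (auto intro: exI[of _ "[]"] simp: awalk_Nil_iff)

lemma tree_vert: "w \<in> T \<Longrightarrow> w \<in> verts E"
  by (simp add: tree_def)

lemma tree_walk: "w \<in> T \<Longrightarrow> awalk w es u \<Longrightarrow> u \<in> T"
  unfolding tree_iff using awalk_appendI by blast

lemma tree_head: "e \<in> arcs E \<Longrightarrow> tail E e \<in> T \<Longrightarrow> head E e \<in> T"
  using tree_walk arc_implies_awalk by blast

lemma tree_arc_unique: "e \<in> arcs E \<Longrightarrow> f \<in> arcs E \<Longrightarrow> tail E e \<in> T \<Longrightarrow> tail E e = tail E f \<Longrightarrow> e = f"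
  using line_point unfolding line_point_def bifurcation_def by metis

text \<open>Descent on the length. If the vertices after the first edge are distinct, the walk is a
  cycle based in the tree, which is excluded; otherwise it contains a shorter nonempty closed walk,
  again based in the tree because its base is reachable from \<open>w\<close>.\<close>

lemma no_closed_walk: "w \<in> T \<Longrightarrow> awalk w p w \<Longrightarrow> p = []"
proof (induction "length p" arbitrary: w p rule: less_induct)
  case less
  show ?case
  proof (rule ccontr)
    assume "p \<noteq> []"
    then obtain e q where p: "p = e # q" by (cases p) auto
    then have e: "e \<in> arcs E" "tail E e = w" "awalk (head E e) q w"
      using less.prems(2) by (auto simp: awalk_Cons_iff)
    show False
    proof (cases "distinct (awalk_verts (head E e) q)")
      case True
      then have "cycle p" using less.prems(2) p by (auto simp: cycle_def)
      then have "cycle_base E w" using less.prems(2) by (auto simp: cycle_base_def)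
      then show False using less.prems(1) line_point by (auto simp: line_point_def)
    next
      case False
      then obtain q1 r q2 u where r: "q = q1 @ r @ q2" "r \<noteq> []" "awalk (head E e) q1 u" "awalk u r u"
        using awalk_not_distinct_decomp[OF e(3)] by blast
      have "u \<in> T"
        using tree_walk[OF tree_head] e(1,2) less.prems(1) r(3) by blast
      then show False using less.hyps[of r u] r p by simp
    qed
  qed
qed

text \<open>Without bifurcations the two walks agree edge by edge. They also stop together, since
  the remainder of the longer one would be a nonempty closed walk.\<close>

lemma tree_walk_unique: "u \<in> T \<Longrightarrow> awalk u p w \<Longrightarrow> awalk u q w \<Longrightarrow> p = q"
proof (induction p arbitrary: u q)
  case Nil
  then show ?case using no_closed_walk by (metis awalk_Nil_iff)
next
  case (Cons e p)
  then show ?case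
  proof (cases q)
    case Nil
    then show ?thesis using Cons.prems no_closed_walk by (metis awalk_Nil_iff)
  next
    case (Cons f q')
    have a: "e \<in> arcs E" "tail E e = u" "awalk (head E e) p w"
      "f \<in> arcs E" "tail E f = u" "awalk (head E f) q' w"
      using Cons.prems \<open>q = f # q'\<close> by (auto simp: awalk_Cons_iff)
    then have "e = f" using tree_arc_unique Cons.prems(1) by metis
    then show ?thesis using Cons.IH[of "head E e" q'] a tree_head Cons.prems(1) \<open>q = f # q'\<close> by auto
  qed
qed

lemma the_path_eq: "awalk v es w \<Longrightarrow> the_path E v w = (v, es)"
  unfolding the_path_def using tree_walk_unique[OF v_tree] by (auto intro!: the_equality)

lemma tree_induct [consumes 1, case_names root step]:
  assumes "w \<in> T" "Q v" "\<And>e. e \<in> arcs E \<Longrightarrow> tail E e \<in> T \<Longrightarrow> Q (tail E e) \<Longrightarrow> Q (head E e)"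
  shows "Q w"
proof -
  have "Q w" if "awalk v es w" for es
    using that
  proof (induction es arbitrary: w rule: rev_induct)
    case Nil
    then show ?case using assms(2) by (simp add: awalk_Nil_iff)
  next
    case (snoc e es)
    then have "awalk v es (tail E e)" "e \<in> arcs E" "head E e = w"
      by (auto simp: awalk_simps)
    then show ?case using assms(3) snoc.IH tree_iff by blast
  qed
  then show ?thesis using assms(1) tree_iff by blast
qed

section \<open>The index set of paths into the tree\<close>

lemma path_Nil_iff [simp]: "(w, []) \<in> P \<longleftrightarrow> w \<in> T"
  by (auto simp: paths_into_tree_def)

text \<open>The recursive form of the index set, on which the inductions over paths rest: an index
  is extended to the left by an edge exactly when that edge starts outside the tree.\<close>

lemma path_Cons_iff:
  "(u, e # es) \<in> P \<longleftrightarrow> e \<in> arcs E \<and> u = tail E e \<and> u \<notin> T \<and> (head E e, es) \<in> P"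
proof (cases es)
  case Nil
  then show ?thesis
    by (auto simp: paths_into_tree_def path_range_def awalk_simps tree_vert)
next
  case (Cons f fs)
  then show ?thesis
    by (auto simp: paths_into_tree_def path_range_def awalk_simps)
qed

lemma path_range_Cons [simp]: "path_range E (u, e # es) = path_range E (head E e, es)"
  by (simp add: path_range_def)

lemma path_source_tree: "\<mu> \<in> P \<Longrightarrow> fst \<mu> \<in> T \<Longrightarrow> \<mu> = (fst \<mu>, [])"
  by (cases \<mu>; cases "snd \<mu>") (auto simp: path_Cons_iff)

lemma path_source_vert: "\<mu> \<in> P \<Longrightarrow> fst \<mu> \<in> verts E"
  by (cases \<mu>; cases "snd \<mu>") (auto simp: path_Cons_iff tree_vert)

lemma path_arcs: "(u, es) \<in> P \<Longrightarrow> set es \<subseteq> arcs E"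
  by (induction es arbitrary: u) (auto simp: path_Cons_iff)

lemma path_range_tree: "(u, es) \<in> P \<Longrightarrow> path_range E (u, es) \<in> T"
  by (induction es arbitrary: u) (auto simp: path_Cons_iff path_range_def split: if_splits)

lemma step_path:
  assumes "g \<in> lpa_gens E" "\<mu> \<in> P" "step E v g \<mu> = Some \<nu>"
  shows "\<nu> \<in> P"
  using assms
  by (cases g; cases \<mu>) (auto simp: path_Cons_iff lpa_gens_def tree_head split: if_splits)

lemma step_path_iff:
  assumes "g \<in> lpa_gens E" "step E v g \<mu> = Some \<nu>"
  shows "\<nu> \<in> P \<longleftrightarrow> \<mu> \<in> P"
  using step_path[OF assms(1) _ assms(2)] step_path[of "star g" \<nu> \<mu>] assms
  by (auto simp: step_star_iff)

text \<open>The partial injections act transitively from the root: edges of the tree carry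
  \<open>(v, [])\<close> to every trivial path, and ghost edges then prepend the edges outside the
  tree one by one.\<close>

lemma path_induct [consumes 1, case_names root step]:
  assumes "\<mu> \<in> P"
    and root: "Q (v, [])"
    and step: "\<And>g \<mu> \<nu>. g \<in> lpa_gens E \<Longrightarrow> \<mu> \<in> P \<Longrightarrow> step E v g \<mu> = Some \<nu> \<Longrightarrow> \<nu> \<in> P \<Longrightarrow> Q \<mu> \<Longrightarrow> Q \<nu>"
  shows "Q \<mu>"
proof -
  have tree: "Q (w, [])" if "w \<in> T" for w
    using that
  proof (induction rule: tree_induct)
    case root
    then show ?case by (rule assms(2))
  next
    case (step e)
    show ?case
      by (rule assms(3)[of "Edge e" "(tail E e, [])"])
        (use step in \<open>auto simp: lpa_gens_def tree_head\<close>)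
  qed
  have "Q (u, es)" if "(u, es) \<in> P" for u es
    using that
  proof (induction es arbitrary: u)
    case Nil
    then show ?case using tree by simp
  next
    case (Cons e es)
    then have e: "e \<in> arcs E" "u = tail E e" "u \<notin> T" "(head E e, es) \<in> P"
      by (auto simp: path_Cons_iff)
    show ?case
      by (rule assms(3)[of "Ghost e" "(head E e, es)"]) (use Cons e in \<open>auto simp: lpa_gens_def\<close>)
  qed
  then show ?thesis using assms(1) by (cases \<mu>) auto
qed

end


section \<open>Leavitt families\<close>

text \<open>Stated for an arbitrary ring so that it can be used twice: in \<open>L\<close> its
  monomials are the \<open>x\<^sub>\<mu>\<close>, in the opposite of \<open>L\<close> with
  \<open>X\<close> and \<open>Y\<close> exchanged they are the \<open>y\<^sub>\<mu>\<close>. CK2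
  appears in the form for a vertex emitting one edge, which is the situation inside the
  tree.\<close>

locale leavitt_family = nonunital_ring R + line_point_graph E v
  for R (structure) and E :: "('v, 'e) pre_digraph" and v :: 'v +
  fixes V :: "'v \<Rightarrow> 'a" and X Y :: "'e \<Rightarrow> 'a"
  assumes V_closed: "u \<in> verts E \<Longrightarrow> V u \<in> carrier R"
    and X_closed: "e \<in> arcs E \<Longrightarrow> X e \<in> carrier R"
    and Y_closed: "e \<in> arcs E \<Longrightarrow> Y e \<in> carrier R"
    and V_mult: "u \<in> verts E \<Longrightarrow> w \<in> verts E \<Longrightarrow> V u \<otimes> V w = (if u = w then V u else \<zero>)"
    and V_X: "e \<in> arcs E \<Longrightarrow> V (tail E e) \<otimes> X e = X e"
    and X_V: "e \<in> arcs E \<Longrightarrow> X e \<otimes> V (head E e) = X e"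
    and V_Y: "e \<in> arcs E \<Longrightarrow> V (head E e) \<otimes> Y e = Y e"
    and Y_V: "e \<in> arcs E \<Longrightarrow> Y e \<otimes> V (tail E e) = Y e"
    and Y_X: "e \<in> arcs E \<Longrightarrow> f \<in> arcs E \<Longrightarrow> Y e \<otimes> X f = (if e = f then V (head E e) else \<zero>)"
    and X_Y: "e \<in> arcs E \<Longrightarrow> {f \<in> arcs E. tail E f = tail E e} = {e} \<Longrightarrow> X e \<otimes> Y e = V (tail E e)"
begin

definition path_prod :: "('v, 'e) path \<Rightarrow> 'a" where
  "path_prod \<mu> = foldl (\<lambda>a e. a \<otimes> X e) (V (fst \<mu>)) (snd \<mu>)"

definition ghost_prod :: "('v, 'e) path \<Rightarrow> 'a" where
  "ghost_prod \<mu> = foldl (\<lambda>a e. Y e \<otimes> a) (V (fst \<mu>)) (snd \<mu>)"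

definition monomial :: "('v, 'e) path \<Rightarrow> 'a" where
  "monomial \<mu> = path_prod \<mu> \<otimes> ghost_prod (the_path E v (path_range E \<mu>))"

definition gen_val :: "('v, 'e) lpa_gen \<Rightarrow> 'a" where
  "gen_val g = (case g of Vertex u \<Rightarrow> V u | Edge e \<Rightarrow> X e | Ghost e \<Rightarrow> Y e)"

abbreviation tree_ghost :: "'v \<Rightarrow> 'a" where
  "tree_ghost w \<equiv> ghost_prod (the_path E v w)"

lemma foldl_closed: "a \<in> carrier R \<Longrightarrow> set es \<subseteq> arcs E \<Longrightarrow> foldl (\<lambda>a e. a \<otimes> X e) a es \<in> carrier R"
  by (induction es arbitrary: a) (auto simp: m_closed X_closed)

lemma foldl_mult:
  "a \<in> carrier R \<Longrightarrow> b \<in> carrier R \<Longrightarrow> set es \<subseteq> arcs E \<Longrightarrow>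
    foldl (\<lambda>a e. a \<otimes> X e) (a \<otimes> b) es = a \<otimes> foldl (\<lambda>a e. a \<otimes> X e) b es"
  by (induction es arbitrary: b) (auto simp: m_assoc m_closed X_closed)

lemma path_prod_closed: "(u, es) \<in> P \<Longrightarrow> path_prod (u, es) \<in> carrier R"
  using path_source_vert by (auto simp: path_prod_def intro!: foldl_closed V_closed dest: path_arcs)

lemma path_prod_Nil [simp]: "path_prod (w, []) = V w"
  by (simp add: path_prod_def)

lemma path_prod_Cons:
  assumes "(tail E e, e # es) \<in> P"
  shows "path_prod (tail E e, e # es) = X e \<otimes> path_prod (head E e, es)"
proof -
  have e: "e \<in> arcs E" "set es \<subseteq> arcs E" using path_arcs[OF assms] by auto
  have "path_prod (tail E e, e # es) = foldl (\<lambda>a e. a \<otimes> X e) (X e \<otimes> V (head E e)) es"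
    using e by (simp add: path_prod_def V_X X_V)
  then show ?thesis using e by (simp add: path_prod_def foldl_mult X_closed V_closed)
qed

lemma V_path_prod:
  assumes "(u, es) \<in> P" "w \<in> verts E"
  shows "V w \<otimes> path_prod (u, es) = (if w = u then path_prod (u, es) else \<zero>)"
proof -
  have u: "u \<in> verts E" "set es \<subseteq> arcs E" using path_source_vert path_arcs assms by fastforce+
  have "path_prod (u, es) = V u \<otimes> path_prod (u, es)"
    using foldl_mult[of "V u" "V u" es] u by (simp add: path_prod_def V_closed V_mult)
  then have "V w \<otimes> path_prod (u, es) = (V w \<otimes> V u) \<otimes> path_prod (u, es)"
    using assms u by (simp add: m_assoc V_closed path_prod_closed)
  then show ?thesis using \<open>path_prod (u, es) = V u \<otimes> path_prod (u, es)\<close> u assms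
    by (auto simp: V_mult l_null path_prod_closed)
qed

lemma the_path_head:
  assumes "e \<in> arcs E" "tail E e \<in> T"
  shows "tree_ghost (head E e) = Y e \<otimes> tree_ghost (tail E e)"
proof -
  obtain es where es: "awalk v es (tail E e)" using assms tree_iff by auto
  then have "awalk v (es @ [e]) (head E e)"
    using assms awalk_appendI arc_implies_awalk by blast
  then show ?thesis
    using the_path_eq[OF es] the_path_eq[of "es @ [e]" "head E e"] by (simp add: ghost_prod_def)
qed

lemma tree_ghost_root: "tree_ghost v = V v"
  using the_path_eq[of "[]" v] v_vert by (simp add: awalk_Nil_iff ghost_prod_def)

lemma tree_ghost_closed: "w \<in> T \<Longrightarrow> tree_ghost w \<in> carrier R"
  by (induction rule: tree_induct)
    (auto simp: tree_ghost_root the_path_head V_closed v_vert m_closed Y_closed)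

lemma V_tree_ghost: "w \<in> T \<Longrightarrow> V w \<otimes> tree_ghost w = tree_ghost w"
  by (induction rule: tree_induct)
    (auto simp: tree_ghost_root the_path_head V_closed V_mult v_vert m_assoc[symmetric] V_Y
      Y_closed tree_ghost_closed)

lemma tree_ghost_V: "w \<in> T \<Longrightarrow> tree_ghost w \<otimes> V v = tree_ghost w"
  by (induction rule: tree_induct)
    (auto simp: tree_ghost_root the_path_head V_closed V_mult v_vert m_assoc V_Y
      Y_closed tree_ghost_closed)

text \<open>CK2 enters the calculus of monomials here. The edge is the only one leaving its source,
  so it cancels the ghost letter by which \<open>tree_ghost\<close> at its head extends
  \<open>tree_ghost\<close> at its tail.\<close>

lemma X_tree_ghost:
  assumes "e \<in> arcs E" "tail E e \<in> T"
  shows "X e \<otimes> tree_ghost (head E e) = tree_ghost (tail E e)"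
proof -
  have "{f \<in> arcs E. tail E f = tail E e} = {e}"
    using assms tree_arc_unique by auto
  then show ?thesis
    using assms by (simp add: the_path_head m_assoc[symmetric] X_closed Y_closed tree_ghost_closed
        X_Y V_tree_ghost)
qed

lemma monomial_closed: "\<mu> \<in> P \<Longrightarrow> monomial \<mu> \<in> carrier R"
  by (cases \<mu>) (auto simp: monomial_def m_closed path_prod_closed tree_ghost_closed path_range_tree)

lemma monomial_root: "monomial (v, []) = V v"
  by (simp add: monomial_def path_range_def tree_ghost_root V_mult v_vert)

lemma monomial_V: "\<mu> \<in> P \<Longrightarrow> monomial \<mu> \<otimes> V v = monomial \<mu>"
  by (cases \<mu>) (auto simp: monomial_def m_assoc path_prod_closed tree_ghost_closed path_range_tree
      V_closed v_vert tree_ghost_V)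

lemma monomial_Nil: "w \<in> T \<Longrightarrow> monomial (w, []) = tree_ghost w"
  by (simp add: monomial_def path_range_def V_tree_ghost)

lemma monomial_Cons:
  "(tail E e, e # es) \<in> P \<Longrightarrow> monomial (tail E e, e # es) = X e \<otimes> monomial (head E e, es)"
  using path_range_tree[of "head E e" es]
  by (auto simp: monomial_def path_prod_Cons m_assoc X_closed path_prod_closed tree_ghost_closed path_Cons_iff)

lemma V_monomial:
  "\<mu> \<in> P \<Longrightarrow> u \<in> verts E \<Longrightarrow> V u \<otimes> monomial \<mu> = (if u = fst \<mu> then monomial \<mu> else \<zero>)"
  by (cases \<mu>) (auto simp: monomial_def m_assoc[symmetric] path_prod_closed tree_ghost_closed
      path_range_tree V_closed V_path_prod l_null)

text \<open>If the ranges fit, an edge outside the tree is prepended to the path. For an edge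
  starting in the tree the path is trivial, and the edge cancels a letter of the ghost part instead.
  If they do not fit, the vertex \<open>head E e\<close> inserted between the factors annihilates
  the product.\<close>

lemma X_monomial:
  assumes "\<mu> \<in> P" "e \<in> arcs E"
  shows "X e \<otimes> monomial \<mu> = (case step E v (Ghost e) \<mu> of None \<Rightarrow> \<zero> | Some \<nu> \<Rightarrow> monomial \<nu>)"
proof (cases "fst \<mu> = head E e")
  case True
  show ?thesis
  proof (cases "tail E e \<in> T")
    case t: True
    then have "\<mu> = (head E e, [])" using True assms path_source_tree tree_head by metis
    then show ?thesis using t assms by (simp add: monomial_Nil X_tree_ghost tree_head)
  next
    case False
    obtain es where "\<mu> = (head E e, es)" using True by (cases \<mu>) auto
    then show ?thesis using False assms by (simp add: monomial_Cons path_Cons_iff)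
  qed
next
  case False
  have "X e \<otimes> monomial \<mu> = X e \<otimes> (V (head E e) \<otimes> monomial \<mu>)"
    using assms by (simp add: m_assoc[symmetric] X_closed V_closed monomial_closed X_V)
  then have "X e \<otimes> monomial \<mu> = \<zero>"
    using False assms by (simp add: V_monomial r_null X_closed)
  moreover have "step E v (Ghost e) \<mu> = None" using False by auto
  ultimately show ?thesis by simp
qed

text \<open>On a nontrivial path, CK1 strips the first edge or gives zero. On a trivial path at the
  source of \<open>e\<close>, the ghost edge lengthens the path in the tree.\<close>

lemma Y_monomial:
  assumes "\<mu> \<in> P" "e \<in> arcs E"
  shows "Y e \<otimes> monomial \<mu> = (case step E v (Edge e) \<mu> of None \<Rightarrow> \<zero> | Some \<nu> \<Rightarrow> monomial \<nu>)"
proof (cases "snd \<mu>")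
  case Nil
  then obtain w where \<mu>: "\<mu> = (w, [])" "w \<in> T" using assms(1) by (cases \<mu>) auto
  show ?thesis
  proof (cases "w = tail E e")
    case True
    then show ?thesis using \<mu> assms by (simp add: monomial_Nil the_path_head tree_head)
  next
    case False
    have "Y e \<otimes> monomial \<mu> = Y e \<otimes> (V (tail E e) \<otimes> monomial \<mu>)"
      using assms by (simp add: m_assoc[symmetric] Y_closed V_closed monomial_closed Y_V)
    then have "Y e \<otimes> monomial \<mu> = \<zero>"
      using False assms \<mu> by (simp add: V_monomial r_null Y_closed)
    moreover have "step E v (Edge e) \<mu> = None" using False \<mu> by auto
    ultimately show ?thesis by simp
  qed
next
  case (Cons f es)
  then have f: "\<mu> = (tail E f, f # es)" "f \<in> arcs E" "tail E f \<notin> T" "(head E f, es) \<in> P"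
    using assms(1) by (cases \<mu>; auto simp: path_Cons_iff)+
  have "Y e \<otimes> monomial \<mu> = (Y e \<otimes> X f) \<otimes> monomial (head E f, es)"
    using assms f by (simp add: monomial_Cons m_assoc Y_closed X_closed monomial_closed)
  also have "\<dots> = (if e = f then monomial (head E f, es) else \<zero>)"
    using assms f by (simp add: Y_X l_null monomial_closed V_monomial)
  finally show ?thesis using f by auto
qed

lemma gen_monomial:
  assumes "\<mu> \<in> P" "g \<in> lpa_gens E"
  shows "gen_val g \<otimes> monomial \<mu> = (case step E v (star g) \<mu> of None \<Rightarrow> \<zero> | Some \<nu> \<Rightarrow> monomial \<nu>)"
  using assms X_monomial[of \<mu>] Y_monomial[of \<mu>]
  by (cases g) (auto simp: gen_val_def V_monomial lpa_gens_def)

end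


text \<open>Turns right multiplication in \<open>R\<close> into left multiplication, so that one
  calculation of monomials covers both sides.\<close>

definition opposite :: "('a, 'm) ring_scheme \<Rightarrow> ('a, 'm) ring_scheme" where
  "opposite R = R\<lparr>mult := \<lambda>x y. y \<otimes>\<^bsub>R\<^esub> x\<rparr>"

lemma opposite_simps [simp]:
  "carrier (opposite R) = carrier R"
  "x \<otimes>\<^bsub>opposite R\<^esub> y = y \<otimes>\<^bsub>R\<^esub> x"
  "x \<oplus>\<^bsub>opposite R\<^esub> y = x \<oplus>\<^bsub>R\<^esub> y"
  "\<zero>\<^bsub>opposite R\<^esub> = \<zero>\<^bsub>R\<^esub>"
  by (simp_all add: opposite_def)

lemma (in nonunital_ring) opposite_nonunital_ring: "nonunital_ring (opposite R)"
proof (intro nonunital_ring.intro nonunital_ring_axioms.intro)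
  have "add_monoid (opposite R) = add_monoid R"
    by (simp add: opposite_def)
  then show "abelian_group (opposite R)"
    using abelian_group_axioms
    by (simp add: abelian_group_def abelian_monoid_def abelian_group_axioms_def)
qed (auto simp: m_closed m_assoc l_distr r_distr)

locale leavitt_line_point = leavitt_algebra E K + line_point_graph E v
  for E :: "('v, 'e) pre_digraph" and K :: "'k::field itself" and v :: 'v
begin

abbreviation Ver :: "'v \<Rightarrow> (('v, 'e) lpa_gen list \<Rightarrow> 'k) set" where "Ver u \<equiv> gen (Vertex u)"
abbreviation Edg :: "'e \<Rightarrow> (('v, 'e) lpa_gen list \<Rightarrow> 'k) set" where "Edg e \<equiv> gen (Edge e)"
abbreviation Gho :: "'e \<Rightarrow> (('v, 'e) lpa_gen list \<Rightarrow> 'k) set" where "Gho e \<equiv> gen (Ghost e)"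

lemma L_CK2:
  assumes e: "e \<in> arcs E" and single: "{f \<in> arcs E. tail E f = tail E e} = {e}"
  shows "Edg e \<otimes>\<^bsub>L\<^esub> Gho e = Ver (tail E e)"
proof -
  have "cls (word [Vertex (tail E e)]) =
      cls (\<lambda>x. \<Sum>f\<in>{f \<in> arcs E. tail E f = tail E e}. word [Edge f, Ghost f] x)"
    using e single by (intro relation_cls lpa_relations.CK2) auto
  then show ?thesis unfolding single using e by (simp add: gen_mult) (simp add: gen_cls)
qed

lemma L_relations:
  "u \<in> verts E \<Longrightarrow> w \<in> verts E \<Longrightarrow> Ver u \<otimes>\<^bsub>L\<^esub> Ver w = (if u = w then Ver u else \<zero>\<^bsub>L\<^esub>)"
  "e \<in> arcs E \<Longrightarrow> Ver (tail E e) \<otimes>\<^bsub>L\<^esub> Edg e = Edg e"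
  "e \<in> arcs E \<Longrightarrow> Edg e \<otimes>\<^bsub>L\<^esub> Ver (head E e) = Edg e"
  "e \<in> arcs E \<Longrightarrow> Ver (head E e) \<otimes>\<^bsub>L\<^esub> Gho e = Gho e"
  "e \<in> arcs E \<Longrightarrow> Gho e \<otimes>\<^bsub>L\<^esub> Ver (tail E e) = Gho e"
  "e \<in> arcs E \<Longrightarrow> f \<in> arcs E \<Longrightarrow> Gho e \<otimes>\<^bsub>L\<^esub> Edg f = (if e = f then Ver (head E e) else \<zero>\<^bsub>L\<^esub>)"
  using lpa_relations.intros[of _ E, THEN relation_cls]
  by (simp_all add: gen_mult) (simp_all add: gen_cls zero_L)

lemma L_family: "leavitt_family L E v Ver Edg Gho"
  by unfold_locales (simp_all add: L_relations L_CK2)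

sublocale A: leavitt_family L E v Ver Edg Gho
  by (rule L_family)

text \<open>The relations of the algebra are preserved when products are reversed and edges are
  exchanged with ghost edges.\<close>

lemma L_op_family: "leavitt_family (opposite L) E v Ver Gho Edg"
proof -
  interpret op: nonunital_ring "opposite L" by (rule L.opposite_nonunital_ring)
  show ?thesis by unfold_locales (simp_all add: L_relations L_CK2)
qed

interpretation B: leavitt_family "opposite L" E v Ver Gho Edg
  by (rule L_op_family)

abbreviation root :: "('v, 'e) path" where "root \<equiv> (v, [])"

abbreviation sterm :: "('v, 'e) path \<Rightarrow> (('v, 'e) lpa_gen list \<Rightarrow> 'k) set" where
  "sterm \<mu> \<equiv> series_term E v \<mu>"

text \<open>Read in \<open>L\<close>, the factors of the opposite monomial come in reverse order:
  the path from \<open>v\<close> stands first and the ghost of \<open>\<mu>\<close> follows. This is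
  \<open>y\<^sub>\<mu>\<close>.\<close>

definition coterm :: "('v, 'e) path \<Rightarrow> (('v, 'e) lpa_gen list \<Rightarrow> 'k) set" where
  "coterm \<mu> = leavitt_family.monomial (opposite L) E v Ver Gho Edg \<mu>"

lemma sterm_monomial: "sterm \<mu> = A.monomial \<mu>"
  by (simp add: series_term_def A.monomial_def path_elt_def ghost_elt_def A.path_prod_def A.ghost_prod_def)

lemma sterm_closed: "\<mu> \<in> P \<Longrightarrow> sterm \<mu> \<in> carrier L"
  by (simp add: sterm_monomial A.monomial_closed)

lemma sterm_root: "sterm root = Ver v"
  by (simp add: sterm_monomial A.monomial_root)

lemma gen_sterm:
  "\<mu> \<in> P \<Longrightarrow> g \<in> lpa_gens E \<Longrightarrow>
    gen g \<otimes>\<^bsub>L\<^esub> sterm \<mu> = (case step E v (star g) \<mu> of None \<Rightarrow> \<zero>\<^bsub>L\<^esub> | Some \<nu> \<Rightarrow> sterm \<nu>)"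
  using A.gen_monomial[of \<mu> g]
  by (cases g) (simp_all add: sterm_monomial[abs_def] A.gen_val_def cong: option.case_cong)

lemma coterm_closed: "\<mu> \<in> P \<Longrightarrow> coterm \<mu> \<in> carrier L"
  using B.monomial_closed by (simp add: coterm_def)

lemma coterm_root: "coterm root = Ver v"
  by (simp add: coterm_def B.monomial_root)

lemma Ver_coterm: "\<mu> \<in> P \<Longrightarrow> Ver v \<otimes>\<^bsub>L\<^esub> coterm \<mu> = coterm \<mu>"
  using B.monomial_V by (simp add: coterm_def)

text \<open>Here the map is \<open>step g\<close>, the same one along which \<open>g\<close> pulls
  back series by \<open>gen_action_step\<close>. This agreement makes the
  \<open>y\<^sub>\<mu>\<close> act as coordinate functionals.\<close>

lemma coterm_gen:
  "\<mu> \<in> P \<Longrightarrow> g \<in> lpa_gens E \<Longrightarrow>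
    coterm \<mu> \<otimes>\<^bsub>L\<^esub> gen g = (case step E v g \<mu> of None \<Rightarrow> \<zero>\<^bsub>L\<^esub> | Some \<nu> \<Rightarrow> coterm \<nu>)"
  using B.gen_monomial[of \<mu> "star g"]
  by (cases g) (simp_all add: coterm_def[abs_def] B.gen_val_def cong: option.case_cong)


section \<open>The formal series module\<close>

abbreviation S :: "((('v, 'e) lpa_gen list \<Rightarrow> 'k) set, ('v, 'e) path \<Rightarrow> 'k) module" where
  "S \<equiv> formal_series_module E v"

abbreviation act :: "('v, 'e) lpa_gen \<Rightarrow> (('v, 'e) path \<Rightarrow> 'k) \<Rightarrow> ('v, 'e) path \<Rightarrow> 'k" where
  "act \<equiv> gen_action E v"

abbreviation word_act :: "(('v, 'e) lpa_gen list \<Rightarrow> 'k) \<Rightarrow> (('v, 'e) path \<Rightarrow> 'k) \<Rightarrow> ('v, 'e) path \<Rightarrow> 'k" where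
  "word_act \<equiv> free_action E v"

lemma S_carrier:
  "p \<in> carrier S \<longleftrightarrow> (\<forall>\<mu>. \<mu> \<notin> P \<longrightarrow> p \<mu> = 0) \<and> finite (fst ` {\<mu>. p \<mu> \<noteq> 0})"
  by (simp add: formal_series_module_def)

lemma S_support: "p \<in> carrier S \<Longrightarrow> p \<mu> \<noteq> 0 \<Longrightarrow> \<mu> \<in> P"
  by (cases \<mu>) (auto simp: S_carrier)

lemma S_outside: "p \<in> carrier S \<Longrightarrow> \<mu> \<notin> P \<Longrightarrow> p \<mu> = 0"
  using S_support by blast

lemma S_finite: "p \<in> carrier S \<Longrightarrow> finite (fst ` {\<mu>. p \<mu> \<noteq> 0})"
  by (simp add: S_carrier)

lemma S_simps [simp]:
  "p \<oplus>\<^bsub>S\<^esub> q = (\<lambda>\<mu>. p \<mu> + q \<mu>)"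
  "\<zero>\<^bsub>S\<^esub> = (\<lambda>_. 0)"
  by (simp_all add: formal_series_module_def)

lemma S_carrierI:
  assumes "\<And>\<mu>. p \<mu> \<noteq> 0 \<Longrightarrow> \<mu> \<in> P \<and> fst \<mu> \<in> A" "finite A"
  shows "p \<in> carrier S"
proof -
  have "fst ` {\<mu>. p \<mu> \<noteq> 0} \<subseteq> A" using assms(1) by auto
  then show ?thesis unfolding S_carrier using assms finite_subset by blast
qed

lemma S_zero_closed [simp]: "(\<lambda>_. 0) \<in> carrier S"
  by (simp add: S_carrier)

lemma S_add_closed:
  assumes "p \<in> carrier S" "q \<in> carrier S"
  shows "(\<lambda>\<mu>. p \<mu> + q \<mu>) \<in> carrier S"
proof (rule S_carrierI)
  show "finite (fst ` {\<mu>. p \<mu> \<noteq> 0} \<union> fst ` {\<mu>. q \<mu> \<noteq> 0})"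
    using assms by (simp add: S_finite)
  show "\<mu> \<in> P \<and> fst \<mu> \<in> fst ` {\<mu>. p \<mu> \<noteq> 0} \<union> fst ` {\<mu>. q \<mu> \<noteq> 0}" if "p \<mu> + q \<mu> \<noteq> 0" for \<mu>
  proof -
    have "p \<mu> \<noteq> 0 \<or> q \<mu> \<noteq> 0" using that by auto
    then show ?thesis using assms S_support by blast
  qed
qed

lemma S_smult_closed: "p \<in> carrier S \<Longrightarrow> (\<lambda>\<mu>. k * p \<mu>) \<in> carrier S"
  by (rule S_carrierI[of _ "fst ` {\<mu>. p \<mu> \<noteq> 0}"]) (auto simp: S_finite S_support)

lemma S_abelian_group: "abelian_group S"
proof (rule abelian_groupI)
  show "\<exists>q\<in>carrier S. q \<oplus>\<^bsub>S\<^esub> p = \<zero>\<^bsub>S\<^esub>" if "p \<in> carrier S" for p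
    using S_smult_closed[OF that, of "-1"] by (intro bexI[of _ "\<lambda>\<mu>. (-1) * p \<mu>"]) auto
qed (auto simp: S_add_closed algebra_simps)

lemma act_closed:
  assumes g: "g \<in> lpa_gens E" and p: "p \<in> carrier S"
  shows "act g p \<in> carrier S"
proof (rule S_carrierI)
  \<comment> \<open>Whatever \<open>p\<close> is, the result lives on paths starting at this one
    vertex, so source finiteness is automatic.\<close>
  let ?u = "case g of Vertex u \<Rightarrow> u | Edge e \<Rightarrow> tail E e | Ghost e \<Rightarrow> head E e"
  show "\<mu> \<in> P \<and> fst \<mu> \<in> {?u}" if nz: "act g p \<mu> \<noteq> 0" for \<mu>
  proof -
    obtain \<nu> where \<nu>: "step E v g \<mu> = Some \<nu>" "p \<nu> \<noteq> 0"
      using nz by (auto simp: gen_action_step split: option.splits)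
    then have "\<nu> \<in> P" using p S_support by blast
    then have "\<mu> \<in> P" using step_path_iff[OF g \<nu>(1)] by simp
    moreover have "fst \<mu> = ?u" using \<nu>(1) by (cases g) (auto split: if_splits)
    ultimately show ?thesis by simp
  qed
qed simp

lemma act_add: "act g (\<lambda>\<mu>. p \<mu> + q \<mu>) = (\<lambda>\<mu>. act g p \<mu> + act g q \<mu>)"
  by (auto simp: gen_action_step split: option.splits)

lemma act_smult: "act g (\<lambda>\<mu>. k * p \<mu>) = (\<lambda>\<mu>. k * act g p \<mu>)"
  by (auto simp: gen_action_step split: option.splits)

section \<open>The action of the free algebra on series\<close>

lemma acts_closed: "set w \<subseteq> lpa_gens E \<Longrightarrow> p \<in> carrier S \<Longrightarrow> foldr act w p \<in> carrier S"
  by (induction w) (auto simp: act_closed)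

lemma acts_add: "foldr act w (\<lambda>\<mu>. p \<mu> + q \<mu>) = (\<lambda>\<mu>. foldr act w p \<mu> + foldr act w q \<mu>)"
  by (induction w) (auto simp: act_add)

lemma acts_smult: "foldr act w (\<lambda>\<mu>. k * p \<mu>) = (\<lambda>\<mu>. k * foldr act w p \<mu>)"
  by (induction w) (auto simp: act_smult)

lemma word_act_superset:
  assumes "finite A" "{w. f w \<noteq> 0} \<subseteq> A"
  shows "word_act f p \<mu> = (\<Sum>w\<in>A. f w * foldr act w p \<mu>)"
  unfolding free_action_def using assms by (intro sum.mono_neutral_left) auto

lemma word_act_word: "word_act (word w) p = foldr act w p"
  by (rule ext) (simp add: word_act_superset[of "{w}"] word_def subset_iff)

lemma word_act_zero: "word_act (\<lambda>_. 0) p = (\<lambda>_. 0)"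
  by (rule ext) (simp add: free_action_def)

lemma word_act_add:
  assumes "f \<in> carrier F" "g \<in> carrier F"
  shows "word_act (\<lambda>w. f w + g w) p = (\<lambda>\<mu>. word_act f p \<mu> + word_act g p \<mu>)"
proof
  fix \<mu>
  let ?A = "{w. f w \<noteq> 0} \<union> {w. g w \<noteq> 0}"
  have A: "finite ?A" "{w. f w \<noteq> 0} \<subseteq> ?A" "{w. g w \<noteq> 0} \<subseteq> ?A" "{w. f w + g w \<noteq> 0} \<subseteq> ?A"
    using assms by (auto simp: free_algebra_carrier)
  show "word_act (\<lambda>w. f w + g w) p \<mu> = word_act f p \<mu> + word_act g p \<mu>"
    unfolding word_act_superset[OF A(1,2)] word_act_superset[OF A(1,3)] word_act_superset[OF A(1,4)]
    by (simp add: distrib_right sum.distrib)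
qed

lemma word_act_smult:
  assumes "f \<in> carrier F"
  shows "word_act (\<lambda>w. k * f w) p = (\<lambda>\<mu>. k * word_act f p \<mu>)"
proof
  fix \<mu>
  have "word_act (\<lambda>w. k * f w) p \<mu> = (\<Sum>w | f w \<noteq> 0. k * f w * foldr act w p \<mu>)"
    using assms by (intro word_act_superset) (auto simp: free_algebra_carrier)
  then show "word_act (\<lambda>w. k * f w) p \<mu> = k * word_act f p \<mu>"
    by (simp add: free_action_def sum_distrib_left mult.assoc)
qed

lemma word_act_closed: "f \<in> carrier F \<Longrightarrow> p \<in> carrier S \<Longrightarrow> word_act f p \<in> carrier S"
  by (induction rule: free_algebra_induct)
    (auto simp: word_act_zero word_act_smult word_act_word word_act_add S_add_closed S_smult_closed acts_closed)

lemma word_act_add_right: "word_act f (\<lambda>\<mu>. p \<mu> + q \<mu>) = (\<lambda>\<mu>. word_act f p \<mu> + word_act f q \<mu>)"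
  by (simp add: free_action_def acts_add distrib_left sum.distrib)

lemma word_act_smult_right: "word_act f (\<lambda>\<mu>. k * p \<mu>) = (\<lambda>\<mu>. k * word_act f p \<mu>)"
  by (simp add: free_action_def acts_smult sum_distrib_left mult.left_commute)

lemma word_act_zero_right: "word_act f (\<lambda>_. 0) = (\<lambda>_. 0)"
  using word_act_smult_right[of f 0 "\<lambda>_. 0"] by simp

text \<open>Nested inductions on \<open>f\<close> and \<open>g\<close> reduce the claim to words,
  where the product is concatenation and the operators compose by \<open>foldr\<close>.\<close>

lemma word_act_mult:
  assumes "f \<in> carrier F" "g \<in> carrier F"
  shows "word_act (f \<otimes>\<^bsub>F\<^esub> g) p = word_act f (word_act g p)"
  using assms(1)
proof (induction rule: free_algebra_induct)
  case zero
  have "(\<lambda>_. 0) \<otimes>\<^bsub>F\<^esub> g = (\<lambda>_. 0)" by (simp add: free_algebra_mult)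
  then show ?case by (simp add: word_act_zero)
next
  case (add f h)
  then show ?case
    using assms(2) by (simp add: free_algebra_l_distr word_act_add free_algebra_mult_closed)
next
  case (word k w)
  have w: "word w \<in> carrier F" using word by simp
  have "word_act (word w \<otimes>\<^bsub>F\<^esub> g) p = word_act (word w) (word_act g p)"
    using assms(2)
  proof (induction rule: free_algebra_induct)
    case zero
    have "word w \<otimes>\<^bsub>F\<^esub> (\<lambda>_. 0) = (\<lambda>_. 0)" by (simp add: free_algebra_mult)
    then show ?case by (simp add: word_act_zero word_act_zero_right)
  next
    case (word l u)
    then have "word u \<in> carrier F" "word (w @ u) \<in> carrier F" using \<open>w \<noteq> []\<close> \<open>set w \<subseteq> lpa_gens E\<close> by auto
    then show ?case
      by (simp add: free_algebra_smult_r word_mult word_act_smult word_act_word acts_smult)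
  next
    case (add f h)
    then show ?case
      using w by (simp add: free_algebra_r_distr word_act_add free_algebra_mult_closed word_act_add_right)
  qed
  then show ?case
    using w assms(2) by (simp add: free_algebra_smult_l word_act_smult free_algebra_mult_closed)
qed

section \<open>The defining relations hold on formal series\<close>

lemma word_act_sum:
  "finite A \<Longrightarrow> (\<And>a. a \<in> A \<Longrightarrow> f a \<in> carrier F) \<Longrightarrow>
    word_act (\<lambda>w. \<Sum>a\<in>A. f a w) p = (\<lambda>\<mu>. \<Sum>a\<in>A. word_act (f a) p \<mu>)"
  by (induction A rule: finite_induct) (auto simp: word_act_zero word_act_add sum_closed)

text \<open>For an edge \<open>e\<close> outside the tree, \<open>e e\<^sup>*\<close> keeps exactly
  the values at paths with first edge \<open>e\<close>, so one summand survives at each path from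
  \<open>u\<close>. If \<open>u\<close> is in the tree, its single edge gives the single summand. At
  all other indices both sides vanish.\<close>

lemma act_CK2:
  assumes u: "u \<in> verts E" and fin: "finite {e \<in> arcs E. tail E e = u}"
    and ne: "{e \<in> arcs E. tail E e = u} \<noteq> {}" and p: "p \<in> carrier S"
  shows "(\<Sum>e | e \<in> arcs E \<and> tail E e = u. act (Edge e) (act (Ghost e) p) \<mu>) = act (Vertex u) p \<mu>"
proof (cases "\<mu> \<in> P \<and> fst \<mu> = u")
  case True
  let ?A = "{e \<in> arcs E. tail E e = u}"
  show ?thesis
  proof (cases "u \<in> T")
    case uT: True
    obtain e where e: "e \<in> arcs E" "tail E e = u" using ne by auto
    then have "?A = {e}" using tree_arc_unique uT by auto
    moreover have "\<mu> = (u, [])" using True path_source_tree[of \<mu>] uT by metis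
    ultimately show ?thesis using uT e by simp
  next
    case False
    obtain f es where \<mu>: "\<mu> = (u, f # es)" using True False by (cases \<mu>; cases "snd \<mu>") auto
    then have f: "f \<in> arcs E" "tail E f = u" using True by (auto simp: path_Cons_iff)
    have "act (Edge e) (act (Ghost e) p) \<mu> = (if e = f then p \<mu> else 0)" if "e \<in> ?A" for e
      using that False \<mu> by auto
    then have "(\<Sum>e\<in>?A. act (Edge e) (act (Ghost e) p) \<mu>) = (\<Sum>e\<in>?A. if e = f then p \<mu> else 0)"
      by (rule sum.cong[OF refl])
    also have "\<dots> = p \<mu>" using f fin by simp
    finally show ?thesis using \<mu> by simp
  qed
next
  case False
  have "act (Edge e) (act (Ghost e) p) \<mu> = 0" if e: "e \<in> arcs E" "tail E e = u" for e
  proof -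
    have "act (Edge e) (act (Ghost e) p) \<in> carrier S"
      using e p by (simp add: act_closed del: gen_action.simps)
    then show ?thesis using False e(2) by (cases "\<mu> \<in> P") (auto simp: S_outside simp del: gen_action.simps, auto)
  qed
  moreover have "act (Vertex u) p \<mu> = 0" using False p by (auto simp: S_outside)
  ultimately show ?thesis by simp
qed

lemma act_CK1:
  assumes "e \<in> arcs E" "f \<in> arcs E" "p \<in> carrier S"
  shows "act (Ghost e) (act (Edge f) p) = (if e = f then act (Vertex (head E e)) p else (\<lambda>_. 0))"
proof
  fix \<mu>
  \<comment> \<open>For an edge of the tree the composite retains only the trivial path at
    \<open>head E e\<close>, whereas the vertex operator retains every path starting there. They
    agree because no other member of the index set starts inside the tree.\<close>
  have out: "p \<mu> = 0" if "tail E e \<in> T" "fst \<mu> = head E e" "\<mu> \<noteq> (head E e, [])"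
    using that assms path_source_tree[of \<mu>] tree_head[of e] S_outside[of p \<mu>] by metis
  show "act (Ghost e) (act (Edge f) p) \<mu> = (if e = f then act (Vertex (head E e)) p else (\<lambda>_. 0)) \<mu>"
  proof (cases "e = f")
    case True
    then show ?thesis using out by (cases \<mu>) auto
  next
    case False
    \<comment> \<open>Operators of tree edges see only the end vertices of the edge, so two
      different edges with a common source in the tree would violate CK1.\<close>
    then have "\<not> (tail E e \<in> T \<and> tail E e = tail E f)" using tree_arc_unique assms by blast
    then show ?thesis using False by (cases \<mu>) auto
  qed
qed

lemma relation_action:
  assumes "(a, b) \<in> lpa_relations E" "p \<in> carrier S"
  shows "word_act a p = word_act b p"
  using assms(1)
proof cases
  case (CK2 u)
  have "word_act b p = (\<lambda>\<mu>. \<Sum>e | e \<in> arcs E \<and> tail E e = u. act (Edge e) (act (Ghost e) p) \<mu>)"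
    unfolding CK2(2) using CK2(4)
    by (subst word_act_sum) (auto simp: word_act_word simp del: gen_action.simps)
  also have "\<dots> = act (Vertex u) p" using act_CK2 CK2 assms(2) by (intro ext) blast
  finally show ?thesis unfolding CK2(1) by (simp add: word_act_word del: gen_action.simps)
next
  case (CK1 e f)
  then show ?thesis
    using act_CK1[OF CK1(3,4) assms(2)] by (auto simp: word_act_word word_act_zero simp del: gen_action.simps)
qed (rule ext; auto simp: word_act_word word_act_zero)+

text \<open>The series has to vary in the induction: for a product \<open>a c\<close>, the ideal
  element \<open>a\<close> acts on the series that \<open>c\<close> has produced.\<close>

lemma ideal_action: "a \<in> I \<Longrightarrow> p \<in> carrier S \<Longrightarrow> word_act a p = (\<lambda>_. 0)"
proof (induction arbitrary: p rule: lpa_ideal.induct)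
  case (rel a b)
  have ab: "a \<in> carrier F" "b \<in> carrier F" using relations_closed rel by auto
  have "word_act (\<lambda>w. a w + (-1) * b w) p = (\<lambda>\<mu>. word_act a p \<mu> + (-1) * word_act b p \<mu>)"
    using ab word_act_add[OF ab(1) free_algebra_smult_closed[OF ab(2), of "-1"]] word_act_smult[OF ab(2), of "-1"]
    by simp
  then show ?case using relation_action rel by simp
next
  case zero
  then show ?case by (simp add: word_act_zero)
next
  case (add a b)
  then show ?case by (simp add: word_act_add ideal_closed)
next
  case (smult a k)
  then show ?case by (simp add: word_act_smult ideal_closed)
next
  case (mult_left a c)
  then show ?case by (simp add: word_act_mult ideal_closed word_act_zero_right)
next
  case (mult_right a c)
  then show ?case by (simp add: word_act_mult ideal_closed word_act_closed)
qed

text \<open>The chosen representative differs from \<open>f\<close> by an element of the ideal,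
  which acts as zero.\<close>

lemma S_smult_cls:
  assumes f: "f \<in> carrier F" and p: "p \<in> carrier S"
  shows "cls f \<odot>\<^bsub>S\<^esub> p = word_act f p"
proof -
  have "(SOME h. h \<in> cls f) \<in> cls f" using cls_self[OF f] by (rule someI[of "\<lambda>h. h \<in> cls f"])
  then obtain i where i: "i \<in> I" "(SOME h. h \<in> cls f) = (\<lambda>w. i w + f w)"
    using cls_memD by blast
  have "cls f \<odot>\<^bsub>S\<^esub> p = word_act (SOME h. h \<in> cls f) p" by (simp add: formal_series_module_def)
  also have "\<dots> = word_act f p"
    unfolding i(2) using i(1) f p by (simp add: word_act_add ideal_closed ideal_action)
  finally show ?thesis .
qed

lemma scale_action:
  "c \<in> carrier L \<Longrightarrow> p \<in> carrier S \<Longrightarrow> scale k c \<odot>\<^bsub>S\<^esub> p = (\<lambda>\<mu>. k * (c \<odot>\<^bsub>S\<^esub> p) \<mu>)"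
  by (auto simp: carrier_L scale_cls S_smult_cls word_act_smult free_algebra_smult_closed)

lemma gen_action_S: "g \<in> lpa_gens E \<Longrightarrow> p \<in> carrier S \<Longrightarrow> gen g \<odot>\<^bsub>S\<^esub> p = act g p"
  by (simp add: gen_cls S_smult_cls word_act_word)

text \<open>The witness is the class of the sum of the vertices in \<open>U\<close>. With
  \<open>U\<close> the finite set of sources of a series, it fixes that series; this is how source
  finiteness yields unitarity.\<close>

lemma local_unit_S:
  assumes "finite U" "U \<subseteq> verts E"
  shows "\<exists>c\<in>carrier L. \<forall>p\<in>carrier S. c \<odot>\<^bsub>S\<^esub> p = (\<lambda>\<mu>. if fst \<mu> \<in> U then p \<mu> else 0)"
proof -
  let ?f = "\<lambda>w. \<Sum>u\<in>U. word [Vertex u] w"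
  have f: "?f \<in> carrier F" using assms by (intro sum_closed) auto
  have "word_act ?f p \<mu> = (if fst \<mu> \<in> U then p \<mu> else 0)" for p \<mu>
    using assms by (subst word_act_sum) (auto simp: word_act_word)
  then show ?thesis using f by (intro bexI[of _ "cls ?f"]) (auto simp: S_smult_cls)
qed

lemma S_module: "unitary_left_module L S"
proof (rule unitary_left_moduleI)
  show "abelian_group S" by (rule S_abelian_group)
  show "\<exists>c\<in>carrier L. \<exists>q\<in>carrier S. p = c \<odot>\<^bsub>S\<^esub> q" if p: "p \<in> carrier S" for p
  proof -
    let ?U = "fst ` {\<mu>. p \<mu> \<noteq> 0}"
    have "?U \<subseteq> verts E" using S_support[OF p] path_source_vert by auto
    then obtain c where c: "c \<in> carrier L" "c \<odot>\<^bsub>S\<^esub> p = (\<lambda>\<mu>. if fst \<mu> \<in> ?U then p \<mu> else 0)"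
      using local_unit_S[of ?U] p S_finite[OF p] by auto
    have "p = c \<odot>\<^bsub>S\<^esub> p" unfolding c(2) by (rule ext) (auto simp: image_iff)
    then show ?thesis using p c(1) by blast
  qed
qed (auto simp: carrier_L cls_add cls_mult S_smult_cls word_act_add word_act_mult word_act_closed word_act_add_right
    free_algebra_add_closed free_algebra_mult_closed S_add_closed)


section \<open>The embedding of the left ideal\<close>

abbreviation LV :: "((('v, 'e) lpa_gen list \<Rightarrow> 'k) set, (('v, 'e) lpa_gen list \<Rightarrow> 'k) set) module" where
  "LV \<equiv> principal_left_ideal L (Ver v)"

definition delta :: "('v, 'e) path \<Rightarrow> ('v, 'e) path \<Rightarrow> 'k" where
  "delta \<mu> = (\<lambda>\<nu>. if \<nu> = \<mu> then 1 else 0)"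

definition embed :: "(('v, 'e) lpa_gen list \<Rightarrow> 'k) set \<Rightarrow> ('v, 'e) path \<Rightarrow> 'k" where
  "embed c = c \<odot>\<^bsub>S\<^esub> delta root"

lemma Ver_v_closed: "Ver v \<in> carrier L"
  by (simp add: v_vert)

lemma Ver_v_idem: "Ver v \<otimes>\<^bsub>L\<^esub> Ver v = Ver v"
  by (simp add: L_relations v_vert)

sublocale S: nonunital_module L S
  by (intro nonunital_module.intro L_nonunital_ring S_module)

lemma LV_module: "unitary_left_module L LV"
  by (rule L.principal_left_ideal_module[OF Ver_v_closed Ver_v_idem])

sublocale LV: nonunital_module L LV
  by (intro nonunital_module.intro L_nonunital_ring LV_module)

lemma delta_closed: "\<mu> \<in> P \<Longrightarrow> delta \<mu> \<in> carrier S"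
  by (rule S_carrierI[of _ "{fst \<mu>}"]) (auto simp: delta_def split: if_splits)

lemma act_delta: "act g (delta \<mu>) = (case step E v (star g) \<mu> of None \<Rightarrow> (\<lambda>_. 0) | Some \<nu> \<Rightarrow> delta \<nu>)"
proof
  fix \<nu>
  have "act g (delta \<mu>) \<nu> = (if step E v (star g) \<mu> = Some \<nu> then 1 else 0)"
    unfolding step_star_iff by (auto simp: gen_action_step delta_def split: option.splits)
  then show "act g (delta \<mu>) \<nu> = (case step E v (star g) \<mu> of None \<Rightarrow> (\<lambda>_. 0) | Some \<nu> \<Rightarrow> delta \<nu>) \<nu>"
    by (auto simp: delta_def split: option.splits)
qed

text \<open>Left multiplication moves \<open>x\<^sub>\<mu>\<close> and the delta series at
  \<open>\<mu>\<close> along the same partial injection, and they correspond at the root.\<close>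

lemma embed_sterm: "\<mu> \<in> P \<Longrightarrow> embed (sterm \<mu>) = delta \<mu>"
proof (induction rule: path_induct)
  case root
  have "act (Vertex v) (delta root) = delta root"
    using act_delta[of "Vertex v" root] by simp
  then show ?case
    by (simp add: embed_def sterm_root gen_action_S v_vert delta_closed del: gen_action.simps)
next
  case (step g \<mu> \<nu>)
  \<comment> \<open>The induction moves indices by \<open>step g\<close>, which on monomials is left
    multiplication by \<open>star g\<close>.\<close>
  have "embed (sterm \<nu>) = (gen (star g) \<otimes>\<^bsub>L\<^esub> sterm \<mu>) \<odot>\<^bsub>S\<^esub> delta root"
    using step by (simp add: embed_def gen_sterm)
  also have "\<dots> = gen (star g) \<odot>\<^bsub>S\<^esub> delta \<mu>"
    using step by (simp add: S.smult_assoc sterm_closed delta_closed embed_def)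
  also have "\<dots> = delta \<nu>"
    using step by (simp add: gen_action_S delta_closed act_delta del: gen_action.simps)
  finally show ?case .
qed

text \<open>The coordinate at \<open>\<mu>\<close> is read off at the root after acting with
  \<open>y\<^sub>\<mu>\<close>. In the induction, a generator on the right of the coterm is shifted
  onto the series, where it changes the evaluation point by the same step.\<close>

lemma coterm_action:
  assumes "\<mu> \<in> P" "p \<in> carrier S"
  shows "(coterm \<mu> \<odot>\<^bsub>S\<^esub> p) root = p \<mu>"
  using assms
proof (induction arbitrary: p rule: path_induct)
  case root
  then show ?case by (simp add: coterm_root gen_action_S v_vert)
next
  case (step g \<mu> \<nu>)
  have "coterm \<nu> \<odot>\<^bsub>S\<^esub> p = (coterm \<mu> \<otimes>\<^bsub>L\<^esub> gen g) \<odot>\<^bsub>S\<^esub> p"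
    using step by (simp add: coterm_gen)
  also have "\<dots> = coterm \<mu> \<odot>\<^bsub>S\<^esub> act g p"
    using step by (simp add: S.smult_assoc coterm_closed gen_action_S)
  finally have "(coterm \<nu> \<odot>\<^bsub>S\<^esub> p) root = act g p \<mu>"
    using step.IH[OF act_closed[OF step.hyps(1) step.prems]] by simp
  then show ?case using step.hyps(3) by (simp add: gen_action_step)
qed

text \<open>The result is fixed by \<open>v\<close>, so it is supported on paths starting at
  \<open>v\<close>; as \<open>v\<close> is in its own tree, only the root is such a path.\<close>

lemma coterm_action_delta:
  assumes "\<mu> \<in> P" "p \<in> carrier S"
  shows "coterm \<mu> \<odot>\<^bsub>S\<^esub> p = (\<lambda>\<nu>. p \<mu> * delta root \<nu>)"
proof
  fix \<nu>
  let ?q = "coterm \<mu> \<odot>\<^bsub>S\<^esub> p"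
  have q: "?q \<in> carrier S" using assms by (simp add: S.smult_closed coterm_closed)
  have "?q = act (Vertex v) ?q"
    using assms q S.smult_assoc[OF Ver_v_closed coterm_closed, of \<mu> p]
    by (simp add: Ver_coterm gen_action_S v_vert del: gen_action.simps)
  then have "?q \<nu> = act (Vertex v) ?q \<nu>" by (rule fun_cong)
  moreover have "?q \<nu> = 0" if "fst \<nu> = v" "\<nu> \<noteq> root"
    using that path_source_tree[of \<nu>] S_outside[OF q, of \<nu>] v_tree by metis
  ultimately show "?q \<nu> = p \<mu> * delta root \<nu>"
    using coterm_action[OF assms] by (auto simp: delta_def split: if_splits)
qed

lemma embed_hom: "embed \<in> left_module_hom L LV S"
proof -
  have d: "delta root \<in> carrier S" by (simp add: delta_closed)
  have LV_L: "x \<in> carrier L" if "x \<in> carrier LV" for x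
    using that Ver_v_closed by (auto simp: L.m_closed)
  show ?thesis
    unfolding left_module_hom_def embed_def
    using d by (auto simp: L.m_closed Ver_v_closed S.smult_closed S.smult_l_distr[symmetric]
        S.smult_assoc[symmetric] simp del: S_simps)
qed

section \<open>Coordinates of elements of the left ideal\<close>

inductive_set span :: "(('v, 'e) lpa_gen list \<Rightarrow> 'k) set set" where
  zero: "\<zero>\<^bsub>L\<^esub> \<in> span"
| incl: "\<mu> \<in> P \<Longrightarrow> scale k (sterm \<mu>) \<in> span"
| add: "s \<in> span \<Longrightarrow> t \<in> span \<Longrightarrow> s \<oplus>\<^bsub>L\<^esub> t \<in> span"

lemma span_closed: "s \<in> span \<Longrightarrow> s \<in> carrier L"
  by (induction rule: span.induct) (auto simp: sterm_closed)

lemma gen_span: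
  assumes g: "g \<in> lpa_gens E" and s: "s \<in> span"
  shows "scale k (gen g) \<otimes>\<^bsub>L\<^esub> s \<in> span"
  using s
proof (induction rule: span.induct)
  case zero
  then show ?case using g by (simp add: L.r_null span.zero)
next
  case (incl \<mu> l)
  have "scale k (gen g) \<otimes>\<^bsub>L\<^esub> scale l (sterm \<mu>) = scale (k * l) (gen g \<otimes>\<^bsub>L\<^esub> sterm \<mu>)"
    using incl g by (simp add: scale_mult_l scale_mult_r sterm_closed L.m_closed scale_scale
        mult.commute)
  moreover have "\<nu> \<in> P" if "step E v (star g) \<mu> = Some \<nu>" for \<nu>
    using step_path[of "star g"] that g incl by simp
  ultimately show ?case
    using incl g by (auto simp: gen_sterm scale_zero span.zero span.incl split: option.splits)
next
  case (add s t)
  then show ?case using g by (simp add: L.r_distr span_closed span.add)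
qed

text \<open>The span is closed under left multiplication; once it is seen to contain
  \<open>v\<close>, it contains the whole left ideal generated by \<open>v\<close>.\<close>

lemma L_span: "c \<in> carrier L \<Longrightarrow> s \<in> span \<Longrightarrow> c \<otimes>\<^bsub>L\<^esub> s \<in> span"
proof (induction arbitrary: s rule: L_induct)
  case zero
  then show ?case by (simp add: L.l_null span_closed span.zero)
next
  case (gen k g)
  then show ?case by (simp add: gen_span)
next
  case (add c d)
  then show ?case by (simp add: L.l_distr span_closed span.add)
next
  case (mult c d)
  then show ?case by (simp add: L.m_assoc span_closed)
qed

lemma LV_span: "carrier LV \<subseteq> span"
proof -
  have "Ver v \<in> span"
    using span.incl[of root 1] by (simp add: sterm_root scale_one v_vert)
  then show ?thesis using L_span by auto
qed

text \<open>Rebuilds an element from its coordinates. It is a genuine sum only for finite support,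
  which is why \<open>unembed_embed\<close> carries a finiteness claim through its
  induction.\<close>

definition unembed :: "(('v, 'e) path \<Rightarrow> 'k) \<Rightarrow> (('v, 'e) lpa_gen list \<Rightarrow> 'k) set" where
  "unembed p = finsum L (\<lambda>\<mu>. scale (p \<mu>) (sterm \<mu>)) {\<mu>. p \<mu> \<noteq> 0}"

lemma unembed_superset:
  assumes "finite A" "A \<subseteq> P" "{\<mu>. p \<mu> \<noteq> 0} \<subseteq> A"
  shows "unembed p = finsum L (\<lambda>\<mu>. scale (p \<mu>) (sterm \<mu>)) A"
  unfolding unembed_def using assms
  by (intro L.add.finprod_mono_neutral_cong_left) (auto simp: scale_0 sterm_closed)

lemma unembed_embed:
  assumes "s \<in> span"
  shows "finite {\<mu>. embed s \<mu> \<noteq> 0} \<and> unembed (embed s) = s"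
  using assms
proof (induction rule: span.induct)
  case zero
  have "embed \<zero>\<^bsub>L\<^esub> = (\<lambda>_. 0)"
    using S.zero_smult[OF delta_closed, of root] by (simp add: embed_def)
  then show ?case by (simp add: unembed_def)
next
  case (incl \<mu> k)
  have e: "embed (scale k (sterm \<mu>)) = (\<lambda>\<nu>. k * delta \<mu> \<nu>)"
    using incl embed_sterm[OF incl] by (simp add: embed_def scale_action sterm_closed delta_closed)
  have sub: "{\<nu>. k * delta \<mu> \<nu> \<noteq> 0} \<subseteq> {\<mu>}" by (auto simp: delta_def split: if_splits)
  then have "unembed (\<lambda>\<nu>. k * delta \<mu> \<nu>) = scale k (sterm \<mu>)"
    using incl unembed_superset[of "{\<mu>}" "\<lambda>\<nu>. k * delta \<mu> \<nu>"] by (simp add: delta_def sterm_closed)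
  then show ?case unfolding e using sub finite_subset by blast
next
  case (add s t)
  have st: "embed s \<in> carrier S" "embed t \<in> carrier S" "s \<in> carrier L" "t \<in> carrier L"
    using add.hyps by (auto simp: embed_def S.smult_closed span_closed delta_closed)
  have e: "embed (s \<oplus>\<^bsub>L\<^esub> t) = (\<lambda>\<mu>. embed s \<mu> + embed t \<mu>)"
    using st by (simp add: embed_def S.smult_l_distr delta_closed)
  \<comment> \<open>Coefficients may cancel in the sum, so all three finite sums are taken over this
    common index set.\<close>
  let ?A = "{\<mu>. embed s \<mu> \<noteq> 0} \<union> {\<mu>. embed t \<mu> \<noteq> 0}"
  have A: "finite ?A" "?A \<subseteq> P" using add.IH st S_support by blast+
  have sub: "{\<mu>. embed s \<mu> + embed t \<mu> \<noteq> 0} \<subseteq> ?A" by auto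
  have "unembed (\<lambda>\<mu>. embed s \<mu> + embed t \<mu>) =
      finsum L (\<lambda>\<mu>. scale (embed s \<mu>) (sterm \<mu>) \<oplus>\<^bsub>L\<^esub> scale (embed t \<mu>) (sterm \<mu>)) ?A"
    unfolding unembed_superset[OF A sub] using A(2)
    by (intro L.add.finprod_cong) (auto simp: simp_implies_def scale_add_l sterm_closed)
  also have "\<dots> = unembed (embed s) \<oplus>\<^bsub>L\<^esub> unembed (embed t)"
    using A unembed_superset[OF A, of "embed s"] unembed_superset[OF A, of "embed t"]
    by (subst L.finsum_addf) (auto simp: sterm_closed)
  finally have "unembed (embed (s \<oplus>\<^bsub>L\<^esub> t)) = s \<oplus>\<^bsub>L\<^esub> t" unfolding e using add.IH by simp
  then show ?case unfolding e using sub A(1) finite_subset by blast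
qed

lemma embed_inj: "inj_on embed (carrier LV)"
  using LV_span unembed_embed by (metis inj_on_inverseI subsetD)

section \<open>Essentiality of the embedded ideal\<close>

lemma hom_image_submodule:
  assumes "unitary_left_module L M" "unitary_left_module L N" "h \<in> left_module_hom L M N"
  shows "submodule (h ` carrier M) L N"
proof -
  interpret M: nonunital_module L M by (intro nonunital_module.intro L_nonunital_ring assms)
  interpret N: nonunital_module L N by (intro nonunital_module.intro L_nonunital_ring assms)
  have hc: "h x \<in> carrier N" if "x \<in> carrier M" for x using assms(3) that by (auto simp: left_module_hom_def)
  have ha: "h (x \<oplus>\<^bsub>M\<^esub> y) = h x \<oplus>\<^bsub>N\<^esub> h y" if "x \<in> carrier M" "y \<in> carrier M" for x y
    using assms(3) that by (auto simp: left_module_hom_def)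
  have hs: "h (r \<odot>\<^bsub>M\<^esub> x) = r \<odot>\<^bsub>N\<^esub> h x" if "r \<in> carrier L" "x \<in> carrier M" for r x
    using assms(3) that by (auto simp: left_module_hom_def)
  have h0: "h \<zero>\<^bsub>M\<^esub> = \<zero>\<^bsub>N\<^esub>"
    using left_module_hom_zero assms(3) M.M.abelian_group_axioms N.M.abelian_group_axioms by blast
  have inv: "\<ominus>\<^bsub>N\<^esub> h x = h (\<ominus>\<^bsub>M\<^esub> x)" if "x \<in> carrier M" for x
    using that ha[of "\<ominus>\<^bsub>M\<^esub> x" x] by (intro N.M.minus_equality) (simp_all add: hc M.M.l_neg h0)
  show ?thesis
  proof (intro submodule.intro submodule_axioms.intro N.M.add.subgroupI)
    show "h ` carrier M \<noteq> {}" using M.M.zero_closed by blast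
  qed (use hc in \<open>auto simp: inv ha[symmetric] hs[symmetric] M.smult_closed\<close>)
qed

lemma embed_essential: "essential_in (embed ` carrier LV) L S"
  unfolding essential_in_def
proof (intro conjI allI impI)
  show "submodule (embed ` carrier LV) L S"
    by (rule hom_image_submodule[OF LV_module S_module embed_hom])
  fix N assume N: "submodule N L S" and ne: "N \<noteq> {\<zero>\<^bsub>S\<^esub>}"
  interpret N: submodule N L S by (rule N)
  have sub: "N \<subseteq> carrier S" using N.subset by simp
  have "\<zero>\<^bsub>S\<^esub> \<in> N" using N.one_closed by simp
  then obtain p where p: "p \<in> N" "p \<noteq> \<zero>\<^bsub>S\<^esub>" using ne by blast
  then obtain \<mu> where \<mu>: "p \<mu> \<noteq> 0"
    by (auto simp: fun_eq_iff simp del: split_paired_All split_paired_Ex)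
  have pS: "p \<in> carrier S" using sub p by blast
  then have \<mu>P: "\<mu> \<in> P" using S_support \<mu> by blast
  let ?q = "\<lambda>\<nu>. p \<mu> * delta root \<nu>"
  have "?q \<in> N"
    using N.smult_closed[OF coterm_closed[OF \<mu>P] p(1)] coterm_action_delta[OF \<mu>P pS] by simp
  moreover have "?q \<in> embed ` carrier LV"
  proof (rule image_eqI)
    show "?q = embed (scale (p \<mu>) (Ver v))"
      using embed_sterm[of root] Ver_v_closed
      by (simp add: embed_def scale_action delta_closed sterm_root)
    show "scale (p \<mu>) (Ver v) \<in> carrier LV"
      using Ver_v_closed scale_mult_l[OF Ver_v_closed Ver_v_closed, of "p \<mu>"]
      by (auto simp: Ver_v_idem intro!: image_eqI[of _ _ "scale (p \<mu>) (Ver v)"])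
  qed
  moreover have "?q \<noteq> \<zero>\<^bsub>S\<^esub>" using \<mu> by (auto simp: delta_def dest!: fun_cong[of _ _ root])
  ultimately show "N \<inter> embed ` carrier LV \<noteq> {\<zero>\<^bsub>S\<^esub>}" by blast
qed


section \<open>Injectivity\<close>

text \<open>A generator is fixed on the left by one vertex and killed by the others. Sums have
  support in the union of the two supports, and a product inherits that of its left factor.\<close>

lemma finite_vertex_support_L:
  assumes "c \<in> carrier L"
  shows "finite {u \<in> verts E. Ver u \<otimes>\<^bsub>L\<^esub> c \<noteq> \<zero>\<^bsub>L\<^esub>}"
  using assms
proof (induction rule: L_induct)
  case zero
  have "{u \<in> verts E. Ver u \<otimes>\<^bsub>L\<^esub> \<zero>\<^bsub>L\<^esub> \<noteq> \<zero>\<^bsub>L\<^esub>} = {}" by (auto simp: L.r_null)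
  then show ?case by (simp only: finite.emptyI)
next
  case (gen k g)
  obtain w where w: "w \<in> verts E" "Ver w \<otimes>\<^bsub>L\<^esub> gen g = gen g"
  proof (cases g)
    case (Vertex u)
    then show ?thesis using gen that[of u] by (simp add: L_relations)
  next
    case (Edge e)
    then show ?thesis using gen that[of "tail E e"] by (simp add: L_relations)
  next
    case (Ghost e)
    then show ?thesis using gen that[of "head E e"] by (simp add: L_relations)
  qed
  have "Ver u \<otimes>\<^bsub>L\<^esub> scale k (gen g) = \<zero>\<^bsub>L\<^esub>" if "u \<in> verts E" "u \<noteq> w" for u
  proof -
    have "Ver u \<otimes>\<^bsub>L\<^esub> gen g = (Ver u \<otimes>\<^bsub>L\<^esub> Ver w) \<otimes>\<^bsub>L\<^esub> gen g"
      using that w gen by (simp add: L.m_assoc)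
    then show ?thesis
      using that w gen by (simp add: scale_mult_r L_relations L.l_null scale_zero)
  qed
  then have "{u \<in> verts E. Ver u \<otimes>\<^bsub>L\<^esub> scale k (gen g) \<noteq> \<zero>\<^bsub>L\<^esub>} \<subseteq> {w}" by blast
  then show ?case using finite_subset by blast
next
  case (add c d)
  have "{u \<in> verts E. Ver u \<otimes>\<^bsub>L\<^esub> (c \<oplus>\<^bsub>L\<^esub> d) \<noteq> \<zero>\<^bsub>L\<^esub>} \<subseteq>
      {u \<in> verts E. Ver u \<otimes>\<^bsub>L\<^esub> c \<noteq> \<zero>\<^bsub>L\<^esub>} \<union> {u \<in> verts E. Ver u \<otimes>\<^bsub>L\<^esub> d \<noteq> \<zero>\<^bsub>L\<^esub>}"
    using add.hyps by (auto simp: L.r_distr)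
  then show ?case by (rule finite_subset) (use add.IH in simp)
next
  case (mult c d)
  have "{u \<in> verts E. Ver u \<otimes>\<^bsub>L\<^esub> (c \<otimes>\<^bsub>L\<^esub> d) \<noteq> \<zero>\<^bsub>L\<^esub>} \<subseteq> {u \<in> verts E. Ver u \<otimes>\<^bsub>L\<^esub> c \<noteq> \<zero>\<^bsub>L\<^esub>}"
  proof -
    have "Ver u \<otimes>\<^bsub>L\<^esub> (c \<otimes>\<^bsub>L\<^esub> d) = (Ver u \<otimes>\<^bsub>L\<^esub> c) \<otimes>\<^bsub>L\<^esub> d" if "u \<in> verts E" for u
      using that mult.hyps by (simp add: L.m_assoc)
    then show ?thesis using L.l_null[OF mult.hyps(2)] by auto
  qed
  then show ?case using mult.IH finite_subset by blast
qed

text \<open>For \<open>r y\<close> the vertices that do not kill it are among those of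
  \<open>r\<close>; unitarity extends the bound from such products to all elements. It supplies the
  source finiteness of \<open>functional_hom\<close>.\<close>

lemma finite_vertex_support_module:
  assumes "unitary_left_module L M" "x \<in> carrier M"
  shows "finite {u \<in> verts E. Ver u \<odot>\<^bsub>M\<^esub> x \<noteq> \<zero>\<^bsub>M\<^esub>}"
proof -
  interpret M: nonunital_module L M by (intro nonunital_module.intro L_nonunital_ring assms)
  let ?G = "{r \<odot>\<^bsub>M\<^esub> x |r x. r \<in> carrier L \<and> x \<in> carrier M}"
  have G: "?G \<subseteq> carrier M" using M.smult_closed by blast
  have G_finite: "finite {u \<in> verts E. Ver u \<odot>\<^bsub>M\<^esub> x \<noteq> \<zero>\<^bsub>M\<^esub>}" if x: "x \<in> ?G" for x
  proof -
    obtain r y where ry: "r \<in> carrier L" "y \<in> carrier M" "x = r \<odot>\<^bsub>M\<^esub> y" using x by blast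
    have "{u \<in> verts E. Ver u \<odot>\<^bsub>M\<^esub> x \<noteq> \<zero>\<^bsub>M\<^esub>} \<subseteq> {u \<in> verts E. Ver u \<otimes>\<^bsub>L\<^esub> r \<noteq> \<zero>\<^bsub>L\<^esub>}"
      using ry by (auto simp: M.smult_assoc[symmetric] M.zero_smult)
    then show ?thesis using finite_vertex_support_L ry(1) finite_subset by blast
  qed
  have neg: "Ver u \<odot>\<^bsub>M\<^esub> (\<ominus>\<^bsub>M\<^esub> x) = \<zero>\<^bsub>M\<^esub>" if "u \<in> verts E" "x \<in> carrier M" "Ver u \<odot>\<^bsub>M\<^esub> x = \<zero>\<^bsub>M\<^esub>" for u x
    using that M.smult_r_distr[of "Ver u" x "\<ominus>\<^bsub>M\<^esub> x"] M.smult_closed[of "Ver u" "\<ominus>\<^bsub>M\<^esub> x"]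
    by (simp add: M.M.r_neg M.smult_zero)
  have "x \<in> generate (add_monoid M) ?G" using assms(2) M.unitary by simp
  then have "x \<in> carrier M \<and> finite {u \<in> verts E. Ver u \<odot>\<^bsub>M\<^esub> x \<noteq> \<zero>\<^bsub>M\<^esub>}"
  proof (induction rule: generate.induct)
    case one
    have "{u \<in> verts E. Ver u \<odot>\<^bsub>M\<^esub> \<zero>\<^bsub>M\<^esub> \<noteq> \<zero>\<^bsub>M\<^esub>} = {}" by (auto simp: M.smult_zero)
    then have "finite {u \<in> verts E. Ver u \<odot>\<^bsub>M\<^esub> \<zero>\<^bsub>M\<^esub> \<noteq> \<zero>\<^bsub>M\<^esub>}" by (simp only: finite.emptyI)
    then show ?case by simp
  next
    case (incl x)
    then show ?case using G G_finite by blast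
  next
    case (inv x)
    have xM: "x \<in> carrier M" using inv G by blast
    have "{u \<in> verts E. Ver u \<odot>\<^bsub>M\<^esub> (\<ominus>\<^bsub>M\<^esub> x) \<noteq> \<zero>\<^bsub>M\<^esub>} \<subseteq> {u \<in> verts E. Ver u \<odot>\<^bsub>M\<^esub> x \<noteq> \<zero>\<^bsub>M\<^esub>}"
      using neg xM by blast
    then have "finite {u \<in> verts E. Ver u \<odot>\<^bsub>M\<^esub> (\<ominus>\<^bsub>M\<^esub> x) \<noteq> \<zero>\<^bsub>M\<^esub>}"
      using G_finite[OF inv] finite_subset by blast
    then show ?case using xM by (simp add: a_inv_def[symmetric])
  next
    case (eng x y)
    have "{u \<in> verts E. Ver u \<odot>\<^bsub>M\<^esub> (x \<oplus>\<^bsub>M\<^esub> y) \<noteq> \<zero>\<^bsub>M\<^esub>} \<subseteq>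
        {u \<in> verts E. Ver u \<odot>\<^bsub>M\<^esub> x \<noteq> \<zero>\<^bsub>M\<^esub>} \<union> {u \<in> verts E. Ver u \<odot>\<^bsub>M\<^esub> y \<noteq> \<zero>\<^bsub>M\<^esub>}"
      using eng.IH by (auto simp: M.smult_r_distr)
    then show ?case using eng.IH finite_subset[OF _ finite_UnI] by auto
  qed
  then show ?thesis by blast
qed

text \<open>
  A homomorphism \<open>h\<close> into the series module is determined by the functional \<open>b \<mapsto> h b v\<close> on
  \<open>vB\<close>, since \<open>h b \<mu> = h (p \<mu>\<^sup>* b) v\<close>; every functional on \<open>vB\<close> arises in this way.
\<close>

definition functional_hom ::
    "((('v, 'e) lpa_gen list \<Rightarrow> 'k) set, 'b) module \<Rightarrow> ('b \<Rightarrow> 'k) \<Rightarrow> 'b \<Rightarrow> ('v, 'e) path \<Rightarrow> 'k" where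
  "functional_hom B m b = (\<lambda>\<mu>. if \<mu> \<in> P then m (coterm \<mu> \<odot>\<^bsub>B\<^esub> b) else 0)"

text \<open>Compatibility with a generator \<open>g\<close> holds because
  \<open>y\<^sub>\<mu> g\<close> and the action of \<open>g\<close> on series follow the same map
  \<open>step g\<close>. Only values of \<open>m\<close> on the part of \<open>B\<close> fixed by
  \<open>v\<close> are used, since every \<open>y\<^sub>\<mu> b\<close> lies there.\<close>

lemma functional_hom:
  fixes B :: "((('v, 'e) lpa_gen list \<Rightarrow> 'k) set, 'b) module"
  assumes B: "unitary_left_module L B"
    and m_add: "\<And>x y. x \<in> carrier B \<Longrightarrow> y \<in> carrier B \<Longrightarrow> Ver v \<odot>\<^bsub>B\<^esub> x = x \<Longrightarrow> Ver v \<odot>\<^bsub>B\<^esub> y = y \<Longrightarrow>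
      m (x \<oplus>\<^bsub>B\<^esub> y) = m x + m y"
    and m_scale: "\<And>k x. x \<in> carrier B \<Longrightarrow> Ver v \<odot>\<^bsub>B\<^esub> x = x \<Longrightarrow> m (scale k (Ver v) \<odot>\<^bsub>B\<^esub> x) = k * m x"
  shows "functional_hom B m \<in> left_module_hom L B S"
proof -
  interpret B: nonunital_module L B by (intro nonunital_module.intro L_nonunital_ring B)
  let ?h = "functional_hom B m"
  have in_vB: "coterm \<mu> \<odot>\<^bsub>B\<^esub> b \<in> carrier B" "Ver v \<odot>\<^bsub>B\<^esub> (coterm \<mu> \<odot>\<^bsub>B\<^esub> b) = coterm \<mu> \<odot>\<^bsub>B\<^esub> b"
    if "\<mu> \<in> P" "b \<in> carrier B" for \<mu> b
    using that Ver_v_closed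
    by (auto simp: B.smult_closed coterm_closed B.smult_assoc[symmetric] Ver_coterm)
  have m_zero: "m \<zero>\<^bsub>B\<^esub> = 0"
    using m_scale[of "\<zero>\<^bsub>B\<^esub>" 0] by (simp add: B.smult_zero v_vert)
  have h_add: "?h (x \<oplus>\<^bsub>B\<^esub> y) = ?h x \<oplus>\<^bsub>S\<^esub> ?h y" if "x \<in> carrier B" "y \<in> carrier B" for x y
    using that by (auto simp: functional_hom_def B.smult_r_distr coterm_closed m_add in_vB)
  have h_S: "?h b \<in> carrier S" if b: "b \<in> carrier B" for b
  proof (rule S_carrierI)
    show "finite {u \<in> verts E. Ver u \<odot>\<^bsub>B\<^esub> b \<noteq> \<zero>\<^bsub>B\<^esub>}" by (rule finite_vertex_support_module[OF B b])
    fix \<mu> assume "?h b \<mu> \<noteq> 0"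
    then have \<mu>: "\<mu> \<in> P" "m (coterm \<mu> \<odot>\<^bsub>B\<^esub> b) \<noteq> 0" by (auto simp: functional_hom_def split: if_splits)
    have u: "fst \<mu> \<in> verts E" using path_source_vert \<mu>(1) by blast
    \<comment> \<open>Inserting the source of \<open>\<mu>\<close> between
      \<open>y\<^sub>\<mu>\<close> and \<open>b\<close> shows that a nonzero value at
      \<open>\<mu>\<close> forces this vertex not to kill \<open>b\<close>.\<close>
    have "coterm \<mu> \<odot>\<^bsub>B\<^esub> b = coterm \<mu> \<odot>\<^bsub>B\<^esub> (Ver (fst \<mu>) \<odot>\<^bsub>B\<^esub> b)"
      using u b \<mu>(1) coterm_gen[of \<mu> "Vertex (fst \<mu>)"]
      by (simp add: B.smult_assoc[symmetric] coterm_closed)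
    then have "Ver (fst \<mu>) \<odot>\<^bsub>B\<^esub> b \<noteq> \<zero>\<^bsub>B\<^esub>"
      using \<mu> m_zero by (auto simp: B.smult_zero coterm_closed)
    then show "\<mu> \<in> P \<and> fst \<mu> \<in> {u \<in> verts E. Ver u \<odot>\<^bsub>B\<^esub> b \<noteq> \<zero>\<^bsub>B\<^esub>}" using \<mu> u by simp
  qed
  have h_gen: "?h (scale k (gen g) \<odot>\<^bsub>B\<^esub> b) \<mu> = k * act g (?h b) \<mu>"
    if g: "g \<in> lpa_gens E" and b: "b \<in> carrier B" for k g b \<mu>
  proof (cases "\<mu> \<in> P")
    case True
    have eq: "coterm \<mu> \<odot>\<^bsub>B\<^esub> (scale k (gen g) \<odot>\<^bsub>B\<^esub> b) = scale k (coterm \<mu> \<otimes>\<^bsub>L\<^esub> gen g) \<odot>\<^bsub>B\<^esub> b"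
      using True g b by (simp add: B.smult_assoc[symmetric] coterm_closed scale_mult_r)
    show ?thesis
    proof (cases "step E v g \<mu>")
      case None
      then show ?thesis
        using True g b eq by (simp add: functional_hom_def coterm_gen scale_zero B.zero_smult m_zero gen_action_step)
    next
      case (Some \<nu>)
      then have \<nu>: "\<nu> \<in> P" using step_path g True by blast
      \<comment> \<open>The scalar is moved onto \<open>v\<close>, where \<open>m_scale\<close>
        applies: on the part fixed by \<open>v\<close>, \<open>k v\<close> acts as the scalar
        \<open>k\<close>.\<close>
      have "scale k (coterm \<nu>) = scale k (Ver v) \<otimes>\<^bsub>L\<^esub> coterm \<nu>"
        using \<nu> by (simp add: scale_mult_l Ver_v_closed coterm_closed Ver_coterm)
      then have "coterm \<mu> \<odot>\<^bsub>B\<^esub> (scale k (gen g) \<odot>\<^bsub>B\<^esub> b) = scale k (Ver v) \<odot>\<^bsub>B\<^esub> (coterm \<nu> \<odot>\<^bsub>B\<^esub> b)"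
        unfolding eq using True Some g b \<nu>
        by (simp add: coterm_gen B.smult_assoc Ver_v_closed coterm_closed del: gen_closed)
      then show ?thesis
        using True \<nu> b Some by (simp add: functional_hom_def m_scale in_vB gen_action_step)
    qed
  next
    case False
    then have "act g (?h b) \<mu> = 0" using S_outside act_closed[OF g h_S[OF b]] by blast
    then show ?thesis using False by (simp add: functional_hom_def)
  qed
  have h_smult: "?h (r \<odot>\<^bsub>B\<^esub> b) = r \<odot>\<^bsub>S\<^esub> ?h b" if "r \<in> carrier L" "b \<in> carrier B" for r b
    using that
  proof (induction arbitrary: b rule: L_induct)
    case zero
    have "?h \<zero>\<^bsub>B\<^esub> = (\<lambda>_. 0)" by (auto simp: functional_hom_def coterm_closed B.smult_zero m_zero)
    then show ?case using zero S.zero_smult h_S by (simp add: B.zero_smult)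
  next
    case (gen k g)
    then show ?case
      using h_gen[of g b k] h_S by (auto simp: scale_action gen_action_S simp del: gen_action.simps)
  next
    case (add c d)
    then show ?case
      by (simp add: B.smult_l_distr S.smult_l_distr h_add h_S B.smult_closed del: S_simps)
  next
    case (mult c d)
    then show ?case by (simp add: B.smult_assoc S.smult_assoc h_S B.smult_closed)
  qed
  show ?thesis
    using h_add h_smult h_S by (auto simp: left_module_hom_def simp del: S_simps)
qed

text \<open>The map \<open>g\<close> is recovered from its root coordinate on the part of
  \<open>A\<close> fixed by \<open>v\<close>. That functional is carried over by \<open>f\<close>,
  extended to the corresponding part of \<open>B\<close>, and turned back into a
  homomorphism.\<close>

lemma S_injective: "injective_module TYPE('a) TYPE('b) L S"
  unfolding injective_module_def
proof (intro allI impI)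
  fix A :: "((('v, 'e) lpa_gen list \<Rightarrow> 'k) set, 'a) module"
    and B :: "((('v, 'e) lpa_gen list \<Rightarrow> 'k) set, 'b) module" and f g
  assume A: "unitary_left_module L A" and B: "unitary_left_module L B"
    and f: "f \<in> left_module_hom L A B" and inj: "inj_on f (carrier A)" and g: "g \<in> left_module_hom L A S"
  interpret A: nonunital_module L A by (intro nonunital_module.intro L_nonunital_ring A)
  interpret B: nonunital_module L B by (intro nonunital_module.intro L_nonunital_ring B)
  have f_closed: "f a \<in> carrier B" if "a \<in> carrier A" for a
    using f that by (auto simp: left_module_hom_def)
  have f_add: "f (x \<oplus>\<^bsub>A\<^esub> y) = f x \<oplus>\<^bsub>B\<^esub> f y" if "x \<in> carrier A" "y \<in> carrier A" for x y
    using f that by (auto simp: left_module_hom_def)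
  have f_smult: "f (r \<odot>\<^bsub>A\<^esub> x) = r \<odot>\<^bsub>B\<^esub> f x" if "r \<in> carrier L" "x \<in> carrier A" for r x
    using f that by (auto simp: left_module_hom_def)
  have g_closed: "g a \<in> carrier S" if "a \<in> carrier A" for a
    using g that by (auto simp: left_module_hom_def)
  have g_add: "g (x \<oplus>\<^bsub>A\<^esub> y) = (\<lambda>\<mu>. g x \<mu> + g y \<mu>)" if "x \<in> carrier A" "y \<in> carrier A" for x y
    using g that by (auto simp: left_module_hom_def)
  have g_smult: "g (r \<odot>\<^bsub>A\<^esub> x) = r \<odot>\<^bsub>S\<^esub> g x" if "r \<in> carrier L" "x \<in> carrier A" for r x
    using g that by (auto simp: left_module_hom_def)
  let ?W = "{b \<in> carrier B. Ver v \<odot>\<^bsub>B\<^esub> b = b}"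
  let ?vA = "{a \<in> carrier A. Ver v \<odot>\<^bsub>A\<^esub> a = a}"
  let ?sc = "\<lambda>k b. scale k (Ver v) \<odot>\<^bsub>B\<^esub> b"
  \<comment> \<open>The root coordinate of \<open>g\<close>, transported to the image of
    \<open>f\<close>.\<close>
  let ?l = "\<lambda>b. g (inv_into (carrier A) f b) root"
  have kv: "scale k (Ver v) \<in> carrier L" "Ver v \<otimes>\<^bsub>L\<^esub> scale k (Ver v) = scale k (Ver v)" for k
    by (simp_all add: Ver_v_closed scale_mult_r Ver_v_idem)
  have l_f: "?l (f a) = g a root" if "a \<in> carrier A" for a
    using that inj by simp
  have vA_sc: "scale k (Ver v) \<odot>\<^bsub>A\<^esub> a \<in> ?vA" if "a \<in> carrier A" for a k
    using that kv by (simp add: A.smult_closed A.smult_assoc[symmetric] Ver_v_closed)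
  have vA_add: "x \<oplus>\<^bsub>A\<^esub> y \<in> ?vA" if "x \<in> ?vA" "y \<in> ?vA" for x y
    using that by (simp add: A.smult_r_distr Ver_v_closed)
  have vA_B: "f ` ?vA \<subseteq> ?W"
    using f_closed f_smult[OF Ver_v_closed] by auto metis
  obtain m where m: "\<And>x y. x \<in> ?W \<Longrightarrow> y \<in> ?W \<Longrightarrow> m (x \<oplus>\<^bsub>B\<^esub> y) = m x + m y"
    "\<And>k x. x \<in> ?W \<Longrightarrow> m (?sc k x) = k * m x" "\<And>x. x \<in> f ` ?vA \<Longrightarrow> m x = ?l x"
  proof (rule B.M.extend_functional[of ?W ?sc "f ` ?vA" ?l])
    show "?W \<subseteq> carrier B" by blast
    show "x \<oplus>\<^bsub>B\<^esub> y \<in> ?W" if "x \<in> ?W" "y \<in> ?W" for x y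
      using that by (simp add: B.smult_r_distr Ver_v_closed)
    show "?sc k x \<in> ?W" if "x \<in> ?W" for k x
      using that kv by (simp add: B.smult_closed B.smult_assoc[symmetric] Ver_v_closed)
    show "?sc (a + b) x = ?sc a x \<oplus>\<^bsub>B\<^esub> ?sc b x" if "x \<in> ?W" for a b x
      using that kv by (simp add: scale_add_l Ver_v_closed B.smult_l_distr)
    show "?sc a (x \<oplus>\<^bsub>B\<^esub> y) = ?sc a x \<oplus>\<^bsub>B\<^esub> ?sc a y" if "x \<in> ?W" "y \<in> ?W" for a x y
      using that kv by (simp add: B.smult_r_distr)
    show "?sc (a * b) x = ?sc a (?sc b x)" if "x \<in> ?W" for a b x
      using that kv by (simp add: B.smult_assoc[symmetric] scale_mult_l Ver_v_closed scale_scale)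
    show "?sc 1 x = x" if "x \<in> ?W" for x
      using that by (simp add: scale_one Ver_v_closed)
    show "f ` ?vA \<subseteq> ?W" by (rule vA_B)
    show "\<zero>\<^bsub>B\<^esub> \<in> f ` ?vA"
    proof (rule image_eqI)
      show "\<zero>\<^bsub>B\<^esub> = f \<zero>\<^bsub>A\<^esub>"
        by (rule left_module_hom_zero[OF A.abelian_group B.abelian_group f, symmetric])
      show "\<zero>\<^bsub>A\<^esub> \<in> ?vA" by (simp add: A.smult_zero Ver_v_closed)
    qed
    show "x \<oplus>\<^bsub>B\<^esub> y \<in> f ` ?vA" if xy: "x \<in> f ` ?vA" "y \<in> f ` ?vA" for x y
    proof -
      obtain a b where ab: "a \<in> ?vA" "b \<in> ?vA" "x = f a" "y = f b" using xy by blast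
      then have "x \<oplus>\<^bsub>B\<^esub> y = f (a \<oplus>\<^bsub>A\<^esub> b)" by (simp add: f_add)
      then show ?thesis using vA_add[OF ab(1,2)] by blast
    qed
    show "?sc k x \<in> f ` ?vA" if x: "x \<in> f ` ?vA" for k x
    proof -
      obtain a where a: "a \<in> carrier A" "x = f a" using x by blast
      then have "?sc k x = f (scale k (Ver v) \<odot>\<^bsub>A\<^esub> a)" by (simp add: f_smult kv(1))
      then show ?thesis using vA_sc[OF a(1)] by blast
    qed
    show "?l (x \<oplus>\<^bsub>B\<^esub> y) = ?l x + ?l y" if xy: "x \<in> f ` ?vA" "y \<in> f ` ?vA" for x y
    proof -
      obtain a b where ab: "a \<in> carrier A" "b \<in> carrier A" "x = f a" "y = f b" using xy by blast
      then have "?l (x \<oplus>\<^bsub>B\<^esub> y) = ?l (f (a \<oplus>\<^bsub>A\<^esub> b))" by (simp add: f_add)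
      then show ?thesis using ab l_f[of "a \<oplus>\<^bsub>A\<^esub> b"] by (simp add: l_f g_add)
    qed
    show "?l (?sc k x) = k * ?l x" if x: "x \<in> f ` ?vA" for k x
    proof -
      obtain a where a: "a \<in> carrier A" "Ver v \<odot>\<^bsub>A\<^esub> a = a" "x = f a" using x by blast
      have "?l (?sc k x) = ?l (f (scale k (Ver v) \<odot>\<^bsub>A\<^esub> a))" using a by (simp add: f_smult kv(1))
      also have "\<dots> = (scale k (Ver v) \<odot>\<^bsub>S\<^esub> g a) root"
        using a vA_sc[of a k] by (simp add: l_f g_smult kv(1))
      also have "\<dots> = k * (Ver v \<odot>\<^bsub>S\<^esub> g a) root"
        using a by (simp add: scale_action Ver_v_closed g_closed)
      also have "Ver v \<odot>\<^bsub>S\<^esub> g a = g a" using g_smult[OF Ver_v_closed a(1)] a(2) by simp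
      finally show ?thesis using a l_f by simp
    qed
    fix m assume m: "\<And>x y. x \<in> ?W \<Longrightarrow> y \<in> ?W \<Longrightarrow> m (x \<oplus>\<^bsub>B\<^esub> y) = m x + m y"
      "\<And>k x. x \<in> ?W \<Longrightarrow> m (?sc k x) = k * m x" "\<And>x. x \<in> f ` ?vA \<Longrightarrow> m x = ?l x"
    show thesis by (rule that[OF m])
  qed
  have "functional_hom B m \<in> left_module_hom L B S"
    by (rule functional_hom[OF B]) (use m in auto)
  moreover have "functional_hom B m (f a) = g a" if a: "a \<in> carrier A" for a
  proof
    fix \<mu>
    show "functional_hom B m (f a) \<mu> = g a \<mu>"
    proof (cases "\<mu> \<in> P")
      case True
      \<comment> \<open>This element is fixed by \<open>v\<close>, so the extended functional is
        prescribed at its image; and the root coordinate of \<open>g ?a\<close> is the coordinate of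
        \<open>g a\<close> at \<open>\<mu>\<close>.\<close>
      let ?a = "coterm \<mu> \<odot>\<^bsub>A\<^esub> a"
      have a': "?a \<in> carrier A" "Ver v \<odot>\<^bsub>A\<^esub> ?a = ?a"
        using True a by (auto simp: A.smult_closed coterm_closed A.smult_assoc[symmetric] Ver_v_closed Ver_coterm)
      have "functional_hom B m (f a) \<mu> = m (f ?a)"
        using True a by (simp add: functional_hom_def f_smult coterm_closed)
      also have "\<dots> = g ?a root" using m(3)[of "f ?a"] a' l_f by auto
      also have "\<dots> = (coterm \<mu> \<odot>\<^bsub>S\<^esub> g a) root" using True a by (simp add: g_smult coterm_closed)
      also have "\<dots> = g a \<mu>" using True a by (simp add: coterm_action g_closed)
      finally show ?thesis .
    next
      case False
      then show ?thesis using S_outside[OF g_closed[OF a]] by (simp add: functional_hom_def)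
    qed
  qed
  ultimately show "\<exists>h\<in>left_module_hom L B S. \<forall>x\<in>carrier A. h (f x) = g x" by blast
qed

end

theorem theorem4p5:
  fixes E :: "('v, 'e) pre_digraph" and v :: 'v
  assumes "wf_digraph E" and "line_point E v"
  shows "\<exists>\<phi> :: (('v, 'e) lpa_gen list \<Rightarrow> 'k::field) set \<Rightarrow> (('v, 'e) path \<Rightarrow> 'k).
    (\<forall>\<mu>\<in>paths_into_tree E v. \<phi> (series_term E v \<mu>) = (\<lambda>\<nu>. if \<nu> = \<mu> then 1 else 0)) \<and>
    injective_envelope TYPE('a) TYPE('b) (leavitt_path_algebra E)
      (principal_left_ideal (leavitt_path_algebra E) (lpa_class E (Vertex v)))
      (formal_series_module E v) \<phi>"
proof -
  interpret leavitt_line_point E "TYPE('k)" v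
    using assms by (simp add: leavitt_line_point_def leavitt_algebra_def line_point_graph_def
        line_point_graph_axioms_def)
  show ?thesis
    using embed_sterm embed_hom embed_inj embed_essential S_injective LV_module S_module
    by (intro exI[of _ embed]) (simp add: injective_envelope_def delta_def)
qed

end
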